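(* For each fixed $x>0$, as $\delta \rightarrow 0$ (with $\delta>0$), $$P\big( \delta (M+\rho) < x\big) = 1-e^{- x } (1+o(\delta)).$$
   Context: For $\delta>0$, let $X_1,X_2,\ldots$ be i.i.d. $N(0,1)$ under $P$, $S_0=0$ and $S_n=\sum_{i=1}^n (X_i-\delta/2)$, a normal random walk with drift $-\delta/2$ and variance $1$. $M=\sup_{0\leq n<\infty}S_n$ (depending on $\delta$). Let $\tau_-=\inf\{n>0: S_n\leq 0\}$. The constant $\rho\approx 0.5826$ is $\rho=-\lim_{\delta\to 0}\dfrac{E[S_{\tau_-}^2]}{2E[S_{\tau_-}]}$. *)

theory Defs
  imports "HOL-Probability.Probability"
begin

definition walk :: "(nat \<Rightarrow> 'a \<Rightarrow> real) \<Rightarrow> real \<Rightarrow> nat \<Rightarrow> 'a \<Rightarrow> real" where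
  "walk X \<delta> n \<omega> = (\<Sum>i=1..n. (X i \<omega> - \<delta> / 2))"

definition walk_max :: "(nat \<Rightarrow> 'a \<Rightarrow> real) \<Rightarrow> real \<Rightarrow> 'a \<Rightarrow> ereal" where
  "walk_max X \<delta> \<omega> = (SUP n. ereal (walk X \<delta> n \<omega>))"

text \<open>For positive drift parameter, on the null event where the walk never enters the nonpositive half-line, the infimum is
  the infimum of the empty set of naturals, namely 0, so the stopped walk below takes the value 0
  there; expectations are unaffected.\<close>

definition tau_minus :: "(nat \<Rightarrow> 'a \<Rightarrow> real) \<Rightarrow> real \<Rightarrow> 'a \<Rightarrow> nat" where
  "tau_minus X \<delta> \<omega> = Inf {n. n > 0 \<and> walk X \<delta> n \<omega> \<le> 0}"

definition stopped_walk :: "(nat \<Rightarrow> 'a \<Rightarrow> real) \<Rightarrow> real \<Rightarrow> 'a \<Rightarrow> real" where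
  "stopped_walk X \<delta> \<omega> = walk X \<delta> (tau_minus X \<delta> \<omega>) \<omega>"

definition rho :: "'a measure \<Rightarrow> (nat \<Rightarrow> 'a \<Rightarrow> real) \<Rightarrow> real" where
  "rho P X = - Lim (at_right 0) (\<lambda>\<delta>.
     (\<integral>\<omega>. (stopped_walk X \<delta> \<omega>)\<^sup>2 \<partial>P) / (2 * (\<integral>\<omega>. stopped_walk X \<delta> \<omega> \<partial>P)))"

end

theory Submission
  imports Defs
begin

text \<open>
  The maximum \<open>M\<close> of the walk has an exactly exponential tail up to the overshoot. Put
  \<open>H(y) = exp (\<delta> y) P (M \<ge> y)\<close>. Conditioning on the first step and tilting the normal density, one finds that
  \<open>H\<close> is harmonic on the positive half-line for the same walk, with boundary values \<open>exp (\<delta> y)\<close> for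
  \<open>y \<le> 0\<close>. So \<open>H(y) = E (exp (-\<delta> R))\<close>, where \<open>R\<close> is the overshoot below 0 of the walk started at \<open>y\<close>. With
  \<open>y = x/\<delta> - \<rho>\<close> the probability in question is
  \<open>1 - exp (-x) exp (\<delta> \<rho>) H(y)\<close>, and the claim says that \<open>H(y) = 1 - \<delta> \<rho> + o(\<delta>)\<close>, that is, the
  deficit \<open>K(y) = (1 - H(y)) / \<delta>\<close> tends to \<open>\<rho>\<close> when \<open>\<delta> \<rightarrow> 0\<close> and \<open>y \<rightarrow> \<infinity>\<close> together
  (\<open>deficit_tendsto\<close>). Three facts give this limit; the errors in them are uniform in
  \<open>\<delta> \<le> 1\<close>.

  Renewal. Let \<open>h\<close> be the height of the first descending ladder step. Stopping gives
  \<open>K(y) = E (K(y - h))\<close> for \<open>y > 0\<close>. Integrated over \<open>(0, Y]\<close>, almost everything cancels and there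
  remains (\<open>integrated_renewal\<close>)
  \<open>E (\<integral>\<^bsub>Y-h\<^esub>\<^bsup>Y\<^esup> K) = E (\<integral>\<^bsub>-h\<^esub>\<^bsup>0\<^esup> K)\<close>. The right side is
  \<open>E (h\<^sup>2) / 2 + O(\<delta>)\<close>, because \<open>K(u)\<close> is about \<open>-u\<close> for \<open>u \<le> 0\<close>.

  Flatness. Far above 0 the function \<open>K\<close> is close to its average over \<open>n\<close> steps of the free walk, and normal laws
  of variance \<open>n\<close> with bounded distance between their means are close in total variation. So \<open>K\<close> is nearly constant on
  bounded intervals near \<open>Y\<close> (\<open>deficit_locally_flat\<close>), the left side is nearly \<open>K(Y) E h\<close>, and
  \<open>K(Y)\<close> is close to \<open>E (h\<^sup>2) / (2 E h)\<close>.

  Moments. A normal step that jumps below 0 overshoots by an amount with bounded fourth moment, whatever the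
  height before it (\<open>overshoot_bound\<close>). As \<open>\<delta> \<rightarrow> 0\<close> the ladder heights converge along almost every path, by recurrence
  of the driftless walk (\<open>alive_probability_tendsto_0\<close>), and with the moment bound their first two moments converge
  (\<open>ladder_moment_tendsto\<close>). So the limit that defines \<open>\<rho>\<close> exists and equals
  \<open>E (h\<^sup>2) / (2 E h)\<close> for the driftless walk.

  Everything takes place on the space of step sequences. The Markov property enters through the independence of
  an initial segment and the rest of the sequence, and statements about stopped walks are proved by induction on a finite horizon.
\<close>

section \<open>Paths and optional stopping\<close>

definition gauss :: "real measure" where
  "gauss = density lborel (\<lambda>x. ennreal (std_normal_density x))"

lemma sets_gauss [measurable_cong, simp]: "sets gauss = sets borel"
  by (simp add: gauss_def)

lemma space_gauss [simp]: "space gauss = UNIV"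
  by (simp add: gauss_def)

interpretation gauss: prob_space gauss
  unfolding gauss_def by (rule prob_space_normal_density) simp

abbreviation paths :: "(nat \<Rightarrow> real) measure" where
  "paths \<equiv> \<Pi>\<^sub>M i\<in>UNIV. gauss"

interpretation paths: prob_space paths
  by (rule prob_space_PiM) (rule gauss.prob_space_axioms)

interpretation path_space: sequence_space gauss
  by unfold_locales

lemma space_paths [simp]: "space paths = UNIV"
  by (simp add: space_PiM)

lemma nn_integral_gauss:
  "f \<in> borel_measurable borel \<Longrightarrow>
    (\<integral>\<^sup>+s. f s \<partial>gauss) = (\<integral>\<^sup>+s. ennreal (std_normal_density s) * f s \<partial>lborel)"
  unfolding gauss_def by (subst nn_integral_density) auto

text \<open>Steps are indexed from 0 and the drift is subtracted from standard normal steps, so that one measure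
  on sequences carries the walks of all drift parameters at once.\<close>

definition position :: "real \<Rightarrow> (nat \<Rightarrow> real) \<Rightarrow> nat \<Rightarrow> real" where
  "position \<delta> \<omega> n = (\<Sum>i<n. (\<omega> i - \<delta> / 2))"

lemma position_0 [simp]: "position \<delta> \<omega> 0 = 0"
  by (simp add: position_def)

lemma position_first_step: "position \<delta> (case_nat s \<omega>) (Suc n) = s - \<delta> / 2 + position \<delta> \<omega> n"
  unfolding position_def by (subst sum.lessThan_Suc_shift) simp

lemma position_drift: "position \<delta> \<omega> n = position 0 \<omega> n - real n * \<delta> / 2"
  by (simp add: position_def sum_subtractf)

lemma measurable_position [measurable]: "(\<lambda>\<omega>. position \<delta> \<omega> n) \<in> borel_measurable paths"
  unfolding position_def by measurable

text \<open>The first step and the remaining steps are independent, and the remaining steps again have the law of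
  the whole sequence. This is the only form of the Markov property that most of the proof needs.\<close>

lemma nn_integral_paths_first_step:
  assumes [measurable]: "F \<in> borel_measurable paths"
  shows "(\<integral>\<^sup>+\<omega>. F \<omega> \<partial>paths) = (\<integral>\<^sup>+s. \<integral>\<^sup>+\<omega>. F (case_nat s \<omega>) \<partial>paths \<partial>gauss)"
proof -
  have "(\<integral>\<^sup>+\<omega>. F \<omega> \<partial>paths) = (\<integral>\<^sup>+\<omega>. F \<omega> \<partial>distr (gauss \<Otimes>\<^sub>M paths) paths (\<lambda>(s, \<omega>). case_nat s \<omega>))"
    by (simp add: path_space.PiM_iter)
  also have "\<dots> = (\<integral>\<^sup>+p. F (case p of (s, \<omega>) \<Rightarrow> case_nat s \<omega>) \<partial>(gauss \<Otimes>\<^sub>M paths))"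
    by (subst nn_integral_distr) auto
  also have "\<dots> = (\<integral>\<^sup>+s. \<integral>\<^sup>+\<omega>. F (case_nat s \<omega>) \<partial>paths \<partial>gauss)"
    by (subst paths.nn_integral_fst[symmetric]) auto
  finally show ?thesis .
qed

text \<open>The walk from height \<open>z\<close> is positive at the times \<open>1, \<dots>, n\<close>. The starting height is not tested,
  which makes \<open>z = 0\<close> the starting point of the first ladder step.\<close>

definition alive :: "real \<Rightarrow> nat \<Rightarrow> real \<Rightarrow> (nat \<Rightarrow> real) \<Rightarrow> bool" where
  "alive \<delta> n z \<omega> \<longleftrightarrow> (\<forall>k<n. z + position \<delta> \<omega> (Suc k) > 0)"

text \<open>The value of \<open>f\<close> at the first position in \<open>(-\<infinity>, 0]\<close> after time 0 if that happens by time \<open>n\<close>, and 0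
  otherwise. At most one summand is nonzero. The finite sum is measurable jointly in height and path,
  and its integrals obey a first-step recursion that needs no strong Markov property.\<close>

definition stopped :: "real \<Rightarrow> nat \<Rightarrow> (real \<Rightarrow> ennreal) \<Rightarrow> real \<Rightarrow> (nat \<Rightarrow> real) \<Rightarrow> ennreal" where
  "stopped \<delta> n f z \<omega> = (\<Sum>k<n. if alive \<delta> k z \<omega> \<and> z + position \<delta> \<omega> (Suc k) \<le> 0
     then f (z + position \<delta> \<omega> (Suc k)) else 0)"

lemma alive_0 [simp]: "alive \<delta> 0 z \<omega>"
  by (simp add: alive_def)

lemma alive_first_step:
  "alive \<delta> (Suc n) z (case_nat s \<omega>) \<longleftrightarrow> z + s - \<delta> / 2 > 0 \<and> alive \<delta> n (z + s - \<delta> / 2) \<omega>"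
  unfolding alive_def
  by (subst All_less_Suc2) (simp add: position_first_step algebra_simps)

lemma stopped_first_step:
  "stopped \<delta> (Suc n) f z (case_nat s \<omega>) =
    (if z + s - \<delta> / 2 \<le> 0 then f (z + s - \<delta> / 2) else stopped \<delta> n f (z + s - \<delta> / 2) \<omega>)"
  unfolding stopped_def
  by (subst sum.lessThan_Suc_shift)
     (auto simp: position_first_step alive_first_step algebra_simps intro!: sum.cong sum.neutral)

lemma measurable_alive [measurable]: "Measurable.pred paths (alive \<delta> n z)"
  unfolding alive_def by measurable

lemma measurable_stopped [measurable]:
  assumes [measurable]: "f \<in> borel_measurable borel"
  shows "stopped \<delta> n f z \<in> borel_measurable paths"
  unfolding stopped_def by measurable

lemma measurable_alive_pair: "Measurable.pred (borel \<Otimes>\<^sub>M paths) (\<lambda>p. alive \<delta> n (fst p) (snd p))"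
  unfolding alive_def position_def by measurable

lemma measurable_stopped_pair:
  assumes [measurable]: "f \<in> borel_measurable borel"
  shows "(\<lambda>p. stopped \<delta> n f (fst p) (snd p)) \<in> borel_measurable (borel \<Otimes>\<^sub>M paths)"
  unfolding stopped_def alive_def position_def by measurable

lemma measurable_expected_stopped [measurable]:
  assumes [measurable]: "f \<in> borel_measurable borel"
  shows "(\<lambda>z. \<integral>\<^sup>+\<omega>. stopped \<delta> n f z \<omega> \<partial>paths) \<in> borel_measurable borel"
  using paths.borel_measurable_nn_integral[of "\<lambda>z. stopped \<delta> n f z" borel]
    measurable_stopped_pair[OF assms, of \<delta> n] by (simp add: case_prod_beta')

lemma expected_stopped_first_step:
  assumes [measurable]: "f \<in> borel_measurable borel"
  shows "(\<integral>\<^sup>+\<omega>. stopped \<delta> (Suc n) f z \<omega> \<partial>paths) =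
    (\<integral>\<^sup>+s. (if z + s - \<delta> / 2 \<le> 0 then f (z + s - \<delta> / 2)
       else (\<integral>\<^sup>+\<omega>. stopped \<delta> n f (z + s - \<delta> / 2) \<omega> \<partial>paths)) \<partial>gauss)"
  by (subst nn_integral_paths_first_step)
     (auto simp: stopped_first_step paths.emeasure_space_1[simplified] intro!: nn_integral_cong)

text \<open>By first-step analysis and induction on the horizon: until the walk dies, the mean value property
  can be applied once more. The start is treated separately because it may be 0, where a function that
  is harmonic on the positive half-line need not have the mean value property.\<close>

lemma optional_stopping:
  assumes [measurable]: "v \<in> borel_measurable borel"
    and harmonic: "\<And>z. z > 0 \<Longrightarrow> v z = (\<integral>\<^sup>+s. v (z + s - \<delta> / 2) \<partial>gauss)"
    and start: "v z = (\<integral>\<^sup>+s. v (z + s - \<delta> / 2) \<partial>gauss)"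
  shows "v z = (\<integral>\<^sup>+\<omega>. stopped \<delta> n v z \<omega> \<partial>paths)
     + (\<integral>\<^sup>+\<omega>. (if alive \<delta> n z \<omega> then v (z + position \<delta> \<omega> n) else 0) \<partial>paths)"
  using start
proof (induction n arbitrary: z)
  case 0
  then show ?case by (simp add: stopped_def paths.emeasure_space_1[simplified])
next
  case (Suc n)
  have [measurable]: "(\<lambda>z. \<integral>\<^sup>+\<omega>. (if alive \<delta> n z \<omega> then v (z + position \<delta> \<omega> n) else 0) \<partial>paths) \<in> borel_measurable borel"
    using paths.borel_measurable_nn_integral[of "\<lambda>z \<omega>. (if alive \<delta> n z \<omega> then v (z + position \<delta> \<omega> n) else 0)" borel]
      measurable_alive_pair[of \<delta> n] by (simp add: case_prod_beta' position_def)
  let ?z = "\<lambda>s. z + s - \<delta> / 2"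
  have "v z = (\<integral>\<^sup>+s. v (?z s) \<partial>gauss)"
    by (rule Suc.prems)
  also have "\<dots> = (\<integral>\<^sup>+s. (if ?z s \<le> 0 then v (?z s) else (\<integral>\<^sup>+\<omega>. stopped \<delta> n v (?z s) \<omega> \<partial>paths))
      + (if ?z s > 0 then (\<integral>\<^sup>+\<omega>. (if alive \<delta> n (?z s) \<omega> then v (?z s + position \<delta> \<omega> n) else 0) \<partial>paths) else 0) \<partial>gauss)"
    using Suc.IH[OF harmonic] by (intro nn_integral_cong) (simp add: not_le)
  also have "\<dots> = (\<integral>\<^sup>+s. (if ?z s \<le> 0 then v (?z s) else (\<integral>\<^sup>+\<omega>. stopped \<delta> n v (?z s) \<omega> \<partial>paths)) \<partial>gauss)
      + (\<integral>\<^sup>+s. (if ?z s > 0 then (\<integral>\<^sup>+\<omega>. (if alive \<delta> n (?z s) \<omega> then v (?z s + position \<delta> \<omega> n) else 0) \<partial>paths) else 0) \<partial>gauss)"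
    by (rule nn_integral_add) measurable
  also have "(\<integral>\<^sup>+s. (if ?z s > 0 then (\<integral>\<^sup>+\<omega>. (if alive \<delta> n (?z s) \<omega> then v (?z s + position \<delta> \<omega> n) else 0) \<partial>paths) else 0) \<partial>gauss)
    = (\<integral>\<^sup>+\<omega>. (if alive \<delta> (Suc n) z \<omega> then v (z + position \<delta> \<omega> (Suc n)) else 0) \<partial>paths)"
    by (subst nn_integral_paths_first_step)
       (auto simp: alive_first_step position_first_step algebra_simps intro!: nn_integral_cong)
  also have "(\<integral>\<^sup>+s. (if ?z s \<le> 0 then v (?z s) else (\<integral>\<^sup>+\<omega>. stopped \<delta> n v (?z s) \<omega> \<partial>paths)) \<partial>gauss)
    = (\<integral>\<^sup>+\<omega>. stopped \<delta> (Suc n) v z \<omega> \<partial>paths)"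
    by (rule expected_stopped_first_step[symmetric]) measurable
  finally show ?case .
qed

section \<open>Gaussian estimates\<close>

lemma integral_gauss:
  fixes f :: "real \<Rightarrow> real"
  shows "f \<in> borel_measurable borel \<Longrightarrow>
    (\<integral>s. f s \<partial>gauss) = (\<integral>s. std_normal_density s * f s \<partial>lborel)"
  unfolding gauss_def by (subst integral_density) auto

lemma integrable_gauss:
  fixes f :: "real \<Rightarrow> real"
  shows "f \<in> borel_measurable borel \<Longrightarrow>
    integrable gauss f \<longleftrightarrow> integrable lborel (\<lambda>s. std_normal_density s * f s)"
  unfolding gauss_def by (subst integrable_density) auto

lemma normal_density_shift: "normal_density \<mu> \<sigma> x = normal_density 0 \<sigma> (x - \<mu>)"
  by (simp add: normal_density_def)

text \<open>The exponential tilt of the normal density is a shift. It drives both the comparison of shifted normal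
  laws and the change of drift from \<open>-\<delta>/2\<close> to \<open>\<delta>/2\<close>.\<close>

lemma normal_density_tilt:
  "std_normal_density s * exp (h * s - h\<^sup>2 / 2) = normal_density h 1 s"
  unfolding normal_density_def
  by (simp add: exp_add[symmetric] power2_eq_square field_simps)

lemma
  shows integrable_gauss_exp: "integrable gauss (\<lambda>s. exp (h * s - h\<^sup>2 / 2))"
    and integral_gauss_exp: "(\<integral>s. exp (h * s - h\<^sup>2 / 2) \<partial>gauss) = 1"
  by (simp_all add: integrable_gauss integral_gauss normal_density_tilt)

lemma gauss_translate:
  fixes f :: "real \<Rightarrow> real"
  assumes [measurable]: "f \<in> borel_measurable borel"
  shows "(\<integral>s. f (s + h) \<partial>gauss) = (\<integral>s. exp (h * s - h\<^sup>2 / 2) * f s \<partial>gauss)"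
proof -
  have "(\<integral>s. f (s + h) \<partial>gauss) = (\<integral>s. std_normal_density s * f (s + h) \<partial>lborel)"
    by (rule integral_gauss) measurable
  also have "\<dots> = (\<integral>s. std_normal_density (s - h) * f s \<partial>lborel)"
    by (subst lborel_integral_real_affine[where c = 1 and t = "-h"]) (simp_all add: algebra_simps)
  also have "\<dots> = (\<integral>s. std_normal_density s * (exp (h * s - h\<^sup>2 / 2) * f s) \<partial>lborel)"
    by (simp add: mult.assoc[symmetric] normal_density_tilt normal_density_shift[of h])
  also have "\<dots> = (\<integral>s. exp (h * s - h\<^sup>2 / 2) * f s \<partial>gauss)"
    by (rule integral_gauss[symmetric]) measurable
  finally show ?thesis .
qed

text \<open>The two normal laws have total variation distance of order \<open>h\<close>. By the tilt, the difference is the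
  expectation of \<open>f\<close> times \<open>Z = exp (h s - h\<^sup>2/2) - 1\<close>, and \<open>Z\<close> has second moment
  \<open>exp (h\<^sup>2) - 1\<close>.\<close>

lemma gauss_translate_bound:
  fixes f :: "real \<Rightarrow> real"
  assumes [measurable]: "f \<in> borel_measurable borel" and bound: "\<And>s. \<bar>f s\<bar> \<le> C"
  shows "\<bar>(\<integral>s. f (s + h) \<partial>gauss) - (\<integral>s. f s \<partial>gauss)\<bar> \<le> C * sqrt (exp (h\<^sup>2) - 1)"
proof -
  define Z where "Z s = exp (h * s - h\<^sup>2 / 2) - 1" for s
  have Z_meas [measurable]: "Z \<in> borel_measurable borel"
    unfolding Z_def by measurable
  have C: "C \<ge> 0" using bound[of 0] by linarith
  have f_int: "integrable gauss f"
    by (rule gauss.integrable_const_bound[where B = C]) (auto simp: bound)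
  have Z_int: "integrable gauss Z"
    unfolding Z_def by (intro Bochner_Integration.integrable_diff integrable_gauss_exp) simp
  have sq: "(Z s)\<^sup>2 = exp (h\<^sup>2) * exp ((2 * h) * s - (2 * h)\<^sup>2 / 2) - 2 * exp (h * s - h\<^sup>2 / 2) + 1" for s
  proof -
    have "exp (h\<^sup>2) * exp ((2 * h) * s - (2 * h)\<^sup>2 / 2) = (exp (h * s - h\<^sup>2 / 2))\<^sup>2"
      by (simp add: exp_double[symmetric] exp_add[symmetric] algebra_simps power2_eq_square)
    then show ?thesis
      by (simp add: Z_def power2_diff)
  qed
  have Z2_int: "integrable gauss (\<lambda>s. (Z s)\<^sup>2)"
    unfolding sq by (intro Bochner_Integration.integrable_add Bochner_Integration.integrable_diff integrable_mult_right integrable_gauss_exp) simp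
  have Z2: "(\<integral>s. (Z s)\<^sup>2 \<partial>gauss) = exp (h\<^sup>2) - 1"
  proof -
    define E1 where "E1 s = exp ((2 * h) * s - (2 * h)\<^sup>2 / 2)" for s
    define E2 where "E2 s = exp (h * s - h\<^sup>2 / 2)" for s
    have "integrable gauss E1" "integrable gauss E2" "(\<integral>s. E1 s \<partial>gauss) = 1" "(\<integral>s. E2 s \<partial>gauss) = 1"
      unfolding E1_def E2_def by (rule integrable_gauss_exp integral_gauss_exp)+
    then show ?thesis
      unfolding sq E1_def[symmetric] E2_def[symmetric] by (simp add: gauss.prob_space[simplified])
  qed
  have fe_int: "integrable gauss (\<lambda>s. exp (h * s - h\<^sup>2 / 2) * f s)"
    using integrable_gauss_exp[of h] C bound
    by (intro Bochner_Integration.integrable_bound[OF integrable_mult_left[OF integrable_gauss_exp[of h], of C]])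
       (auto simp: abs_mult intro!: mult_left_mono)
  have "(\<integral>s. f (s + h) \<partial>gauss) - (\<integral>s. f s \<partial>gauss) = (\<integral>s. Z s * f s \<partial>gauss)"
    unfolding gauss_translate[OF assms(1)]
    by (subst Bochner_Integration.integral_diff[OF fe_int f_int, symmetric]) (simp add: Z_def left_diff_distrib)
  also have "\<bar>\<dots>\<bar> \<le> (\<integral>s. C * \<bar>Z s\<bar> \<partial>gauss)"
  proof (rule integral_abs_bound_integral)
    have "integrable gauss (\<lambda>s. exp (h * s - h\<^sup>2 / 2) * f s - f s)"
      by (intro Bochner_Integration.integrable_diff fe_int f_int)
    then show "integrable gauss (\<lambda>s. Z s * f s)"
      by (simp add: Z_def left_diff_distrib)
    show "\<bar>Z s * f s\<bar> \<le> C * \<bar>Z s\<bar>" for s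
      using mult_right_mono[OF bound[of s], of "\<bar>Z s\<bar>"] by (simp add: abs_mult mult.commute)
  qed (use Z_int in simp)
  also have "\<dots> = C * (\<integral>s. \<bar>Z s\<bar> \<partial>gauss)"
    by simp
  also have "\<dots> \<le> C * sqrt (exp (h\<^sup>2) - 1)"
  proof (intro mult_left_mono C real_le_rsqrt)
    have "0 \<le> gauss.variance (\<lambda>s. \<bar>Z s\<bar>)"
      by (rule gauss.variance_positive)
    also have "\<dots> = (\<integral>s. (Z s)\<^sup>2 \<partial>gauss) - (\<integral>s. \<bar>Z s\<bar> \<partial>gauss)\<^sup>2"
      using Z_int Z2_int by (subst gauss.variance_eq) auto
    finally show "(\<integral>s. \<bar>Z s\<bar> \<partial>gauss)\<^sup>2 \<le> exp (h\<^sup>2) - 1"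
      by (simp add: Z2)
  qed
  finally show ?thesis .
qed

lemma indep_steps: "paths.indep_vars (\<lambda>_. borel) (\<lambda>i \<omega>. \<omega> i) UNIV"
proof (subst paths.indep_vars_iff_distr_eq_PiM')
  have "distr paths (\<Pi>\<^sub>M i\<in>UNIV. borel) (\<lambda>\<omega>. \<lambda>i\<in>UNIV. \<omega> i) = distr paths paths (\<lambda>\<omega>. \<omega>)"
    by (rule distr_cong) (auto intro!: sets_PiM_cong)
  also have "\<dots> = paths" by simp
  also have "\<dots> = (\<Pi>\<^sub>M i\<in>UNIV. distr paths borel (\<lambda>\<omega>. \<omega> i))"
  proof (rule PiM_cong[OF refl])
    fix i :: nat
    have "distr paths borel (\<lambda>\<omega>. \<omega> i) = distr paths gauss (\<lambda>\<omega>. \<omega> i)"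
      by (rule distr_cong) auto
    also have "\<dots> = gauss"
      by (rule distr_PiM_component) (auto intro: gauss.prob_space_axioms)
    finally show "gauss = distr paths borel (\<lambda>\<omega>. \<omega> i)" ..
  qed
  finally show "distr paths (\<Pi>\<^sub>M i\<in>UNIV. borel) (\<lambda>\<omega>. \<lambda>i\<in>UNIV. \<omega> i)
      = (\<Pi>\<^sub>M i\<in>UNIV. distr paths borel (\<lambda>\<omega>. \<omega> i))" .
qed auto

lemma distributed_step: "distributed paths lborel (\<lambda>\<omega>. \<omega> i) std_normal_density"
proof -
  have "distr paths lborel (\<lambda>\<omega>. \<omega> i) = distr paths gauss (\<lambda>\<omega>. \<omega> i)"
    by (rule distr_cong) auto
  also have "\<dots> = gauss"
    by (rule distr_PiM_component) (auto intro: gauss.prob_space_axioms)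
  finally show ?thesis
    unfolding distributed_def by (simp add: gauss_def)
qed

lemma distr_position:
  assumes "n > 0"
  shows "distr paths lborel (\<lambda>\<omega>. position 0 \<omega> n / sqrt (real n)) = gauss"
proof -
  have "paths.indep_vars (\<lambda>_. borel) (\<lambda>i \<omega>. \<omega> i) {..<n}"
    by (rule paths.indep_vars_subset[OF indep_steps]) auto
  then have "distributed paths lborel (\<lambda>\<omega>. \<Sum>i<n. \<omega> i) (normal_density (\<Sum>i<n. 0) (sqrt (\<Sum>i<n. 1\<^sup>2)))"
    using assms distributed_step by (intro paths.sum_indep_normal) auto
  then have "distributed paths lborel (\<lambda>\<omega>. position 0 \<omega> n) (normal_density 0 (sqrt (real n)))"
    by (simp add: position_def)
  then have "distributed paths lborel (\<lambda>\<omega>. (position 0 \<omega> n - 0) / sqrt (real n)) std_normal_density"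
    using assms by (subst (asm) paths.normal_standard_normal_convert) auto
  then show ?thesis
    by (simp add: distributed_def gauss_def)
qed

lemma nn_integral_position:
  assumes "n > 0" and [measurable]: "f \<in> borel_measurable borel"
  shows "(\<integral>\<^sup>+\<omega>. f (position 0 \<omega> n) \<partial>paths) = (\<integral>\<^sup>+s. f (sqrt (real n) * s) \<partial>gauss)"
proof -
  have "(\<integral>\<^sup>+s. f (sqrt (real n) * s) \<partial>gauss)
      = (\<integral>\<^sup>+s. f (sqrt (real n) * s) \<partial>distr paths lborel (\<lambda>\<omega>. position 0 \<omega> n / sqrt (real n)))"
    by (simp add: distr_position assms)
  also have "\<dots> = (\<integral>\<^sup>+\<omega>. f (position 0 \<omega> n) \<partial>paths)"
    using assms by (subst nn_integral_distr) auto
  finally show ?thesis ..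
qed

lemma integral_position:
  fixes f :: "real \<Rightarrow> real"
  assumes "n > 0" and [measurable]: "f \<in> borel_measurable borel"
  shows "(\<integral>\<omega>. f (position 0 \<omega> n) \<partial>paths) = (\<integral>s. f (sqrt (real n) * s) \<partial>gauss)"
proof -
  have "(\<integral>s. f (sqrt (real n) * s) \<partial>gauss)
      = (\<integral>s. f (sqrt (real n) * s) \<partial>distr paths lborel (\<lambda>\<omega>. position 0 \<omega> n / sqrt (real n)))"
    by (simp add: distr_position assms)
  also have "\<dots> = (\<integral>\<omega>. f (position 0 \<omega> n) \<partial>paths)"
    using assms by (subst integral_distr) auto
  finally show ?thesis ..
qed

text \<open>After \<open>n\<close> steps the walk has forgotten a bounded difference of starting heights, since the normal law of
  variance \<open>n\<close> hardly changes under a bounded shift.\<close>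

lemma position_translate_bound:
  fixes f :: "real \<Rightarrow> real"
  assumes n: "n > 0" and [measurable]: "f \<in> borel_measurable borel" and bound: "\<And>s. \<bar>f s\<bar> \<le> C"
  shows "\<bar>(\<integral>\<omega>. f (x + position \<delta> \<omega> n) \<partial>paths) - (\<integral>\<omega>. f (y + position \<delta> \<omega> n) \<partial>paths)\<bar>
    \<le> C * sqrt (exp ((x - y)\<^sup>2 / real n) - 1)"
proof -
  define g where "g s = f (y - real n * \<delta> / 2 + sqrt (real n) * s)" for s
  have [measurable]: "g \<in> borel_measurable borel"
    unfolding g_def by measurable
  have "(\<integral>\<omega>. f (y + position \<delta> \<omega> n) \<partial>paths) = (\<integral>\<omega>. f (y - real n * \<delta> / 2 + position 0 \<omega> n) \<partial>paths)"
    by (subst position_drift) (simp add: algebra_simps)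
  also have "\<dots> = (\<integral>s. g s \<partial>gauss)"
    using n unfolding g_def by (intro integral_position) measurable
  finally have y: "(\<integral>\<omega>. f (y + position \<delta> \<omega> n) \<partial>paths) = (\<integral>s. g s \<partial>gauss)" .
  have "(\<integral>\<omega>. f (x + position \<delta> \<omega> n) \<partial>paths) = (\<integral>\<omega>. f (x - real n * \<delta> / 2 + position 0 \<omega> n) \<partial>paths)"
    by (subst position_drift) (simp add: algebra_simps)
  also have "\<dots> = (\<integral>s. f (x - real n * \<delta> / 2 + sqrt (real n) * s) \<partial>gauss)"
    using n by (intro integral_position) measurable
  also have "\<dots> = (\<integral>s. g (s + (x - y) / sqrt (real n)) \<partial>gauss)"
  proof -
    have "y - real n * \<delta> / 2 + sqrt (real n) * (s + (x - y) / sqrt (real n))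
        = x - real n * \<delta> / 2 + sqrt (real n) * s" for s
      using n by (simp add: distrib_left)
    then show ?thesis by (simp only: g_def)
  qed
  finally show ?thesis
    unfolding y using gauss_translate_bound[of g C "(x - y) / sqrt (real n)"] bound n
    by (simp add: power_divide) (simp add: g_def)
qed

lemma quartic_shift: "(u::real) ^ 4 \<le> 8 * (u + 1/2) ^ 4 + 1"
proof -
  have "u\<^sup>2 \<le> 2 * (u + 1/2)\<^sup>2 + 1/2"
    using zero_le_power2[of "u + 1"] by (simp add: power2_eq_square algebra_simps)
  then have "(u\<^sup>2)\<^sup>2 \<le> (2 * (u + 1/2)\<^sup>2 + 1/2)\<^sup>2"
    by (intro power_mono) auto
  also have "\<dots> \<le> 8 * ((u + 1/2)\<^sup>2)\<^sup>2 + 1"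
    using zero_le_power2[of "2 * (u + 1/2)\<^sup>2 - 1/2"] by (simp add: power2_eq_square algebra_simps)
  finally show ?thesis by (simp add: power_mult[symmetric])
qed

text \<open>A normal step that is known to jump below 0 from a height \<open>z \<ge> 0\<close> overshoots by an amount whose fourth
  moment is bounded, uniformly in \<open>z\<close> and the drift. With \<open>a = z - \<delta>/2 \<ge> -1/2\<close>, the density of the new
  position \<open>u \<le> 0\<close> is proportional to \<open>exp ((a + 1/2) u)\<close> times the density for \<open>a = -1/2\<close>. The larger
  \<open>a\<close> is, the more this weight favours small overshoots, so Chebyshev's association inequality shows that
  \<open>a = -1/2\<close> is the worst case. The summand 1 lets the same constant serve all lower moments.\<close>

lemma overshoot_bound:
  obtains c :: real where "c \<ge> 1"
    and "\<And>z \<delta>. z \<ge> 0 \<Longrightarrow> \<delta> \<le> 1 \<Longrightarrow>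
      (\<integral>\<^sup>+s. (if z + s - \<delta> / 2 \<le> 0 then ennreal (1 + (z + s - \<delta> / 2) ^ 4) else 0) \<partial>gauss)
      \<le> ennreal c * (\<integral>\<^sup>+s. (if z + s - \<delta> / 2 \<le> 0 then 1 else 0) \<partial>gauss)"
proof -
  define w where "w u = indicator {..0::real} u * normal_density (-1/2) 1 u" for u
  define f where "f u = 1 + u ^ 4" for u :: real
  have [measurable]: "w \<in> borel_measurable borel" "f \<in> borel_measurable borel"
    unfolding w_def f_def by measurable
  have w_nonneg: "w u \<ge> 0" and w_le: "w u \<le> normal_density (-1/2) 1 u" for u
    by (auto simp: w_def indicator_def)
  have f_ge: "f u \<ge> 1" for u by (simp add: f_def)
  have w_int: "integrable lborel w"
    by (rule Bochner_Integration.integrable_bound[of _ "normal_density (-1/2) 1"])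
       (use w_nonneg w_le in auto)
  have fw_int: "integrable lborel (\<lambda>u. f u * w u)"
  proof (rule Bochner_Integration.integrable_bound)
    show "integrable lborel (\<lambda>u. 2 * normal_density (-1/2) 1 u + 8 * (normal_density (-1/2) 1 u * (u - (-1/2)) ^ 4))"
      by (intro Bochner_Integration.integrable_add integrable_mult_right integrable_normal_moment) auto
    have "f u * w u \<le> (2 + 8 * (u - (-1/2)) ^ 4) * normal_density (-1/2) 1 u" for u
      using quartic_shift[of u] w_nonneg w_le by (intro mult_mono) (auto simp: f_def)
    then have "norm (f u * w u) \<le> norm (2 * normal_density (-1/2) 1 u + 8 * (normal_density (-1/2) 1 u * (u - (-1/2)) ^ 4))" for u
      using w_nonneg[of u] f_ge[of u] by (simp add: algebra_simps abs_mult)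
    then show "AE u in lborel. norm (f u * w u) \<le> norm (2 * normal_density (-1/2) 1 u + 8 * (normal_density (-1/2) 1 u * (u - (-1/2)) ^ 4))"
      by simp
  qed measurable
  define B where "B = (\<integral>u. w u \<partial>lborel)"
  define A where "A = (\<integral>u. f u * w u \<partial>lborel)"
  have "B > 0"
  proof -
    define k where "k = exp (- 1 / 8) / sqrt (2 * pi)"
    have "k * indicator {-1..0} u \<le> w u" for u
    proof (cases "u \<in> {-1..0}")
      case True
      then have "(u + 1/2)\<^sup>2 \<le> (1/2)\<^sup>2"
        by (intro abs_le_square_iff[THEN iffD1]) (simp add: abs_if, linarith?)
      then show ?thesis
        using True by (simp add: k_def w_def normal_density_def divide_right_mono power2_eq_square)
    qed (use w_nonneg in auto)
    then have "(\<integral>u. k * indicator {-1..0::real} u \<partial>lborel) \<le> B"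
      unfolding B_def using w_int by (intro integral_mono) auto
    moreover have "k > 0" by (simp add: k_def)
    ultimately show ?thesis by simp
  qed
  define c where "c = A / B"
  have "B \<le> A"
    unfolding A_def B_def
  proof (rule integral_mono[OF w_int fw_int])
    show "w u \<le> f u * w u" for u
      using mult_right_mono[OF f_ge[of u] w_nonneg[of u]] by simp
  qed
  then have c: "c \<ge> 1" using \<open>B > 0\<close> by (simp add: c_def)
  have A_eq: "A = c * B" using \<open>B > 0\<close> by (simp add: c_def)
  \<comment> \<open>\<open>u0\<close> is the point where \<open>f\<close> crosses its conditional mean \<open>c\<close> in the worst case\<close>
  define u0 where "u0 = - root 4 (c - 1)"
  have u0: "u0 \<le> 0" "f u0 = c"
    using c by (auto simp: u0_def f_def)
  have "(\<integral>\<^sup>+s. (if z + s - \<delta> / 2 \<le> 0 then ennreal (1 + (z + s - \<delta> / 2) ^ 4) else 0) \<partial>gauss)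
      \<le> ennreal c * (\<integral>\<^sup>+s. (if z + s - \<delta> / 2 \<le> 0 then 1 else 0) \<partial>gauss)"
    if "z \<ge> 0" "\<delta> \<le> 1" for z \<delta>
  proof -
    define a where "a = z - \<delta> / 2"
    define l where "l = a + 1 / 2"
    define k where "k = exp ((1 / 4 - a\<^sup>2) / 2)"
    have l: "l \<ge> 0" using that by (simp add: l_def a_def)
    have k: "k > 0" by (simp add: k_def)
    have dens: "indicator {..0} u * std_normal_density (u - a) = k * exp (l * u) * w u" for u
      unfolding w_def normal_density_def k_def l_def
      by (auto simp: exp_add[symmetric] power2_eq_square field_simps indicator_def)
    have change: "(\<integral>\<^sup>+s. (if z + s - \<delta> / 2 \<le> 0 then ennreal (g (z + s - \<delta> / 2)) else 0) \<partial>gauss)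
        = (\<integral>\<^sup>+u. ennreal (g u * (k * exp (l * u) * w u)) \<partial>lborel)"
      if [measurable]: "g \<in> borel_measurable borel" and g: "\<And>u. g u \<ge> 0" for g :: "real \<Rightarrow> real"
    proof -
      have "(\<integral>\<^sup>+s. (if z + s - \<delta> / 2 \<le> 0 then ennreal (g (z + s - \<delta> / 2)) else 0) \<partial>gauss)
        = (\<integral>\<^sup>+s. ennreal (std_normal_density s) * (if a + s \<le> 0 then ennreal (g (a + s)) else 0) \<partial>lborel)"
        by (subst nn_integral_gauss) (auto simp: a_def algebra_simps intro!: nn_integral_cong)
      also have "\<dots> = (\<integral>\<^sup>+u. ennreal (std_normal_density (u - a)) * (if u \<le> 0 then ennreal (g u) else 0) \<partial>lborel)"
        by (subst nn_integral_real_affine[where c = 1 and t = "-a"])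
           (auto intro!: nn_integral_cong)
      also have "\<dots> = (\<integral>\<^sup>+u. ennreal (g u * (k * exp (l * u) * w u)) \<partial>lborel)"
        unfolding dens[symmetric]
        by (intro nn_integral_cong) (auto simp: indicator_def g ennreal_mult[symmetric] mult.commute)
      finally show ?thesis .
    qed
    define e0 where "e0 = k * exp (l * u0)"
    have e0: "e0 \<ge> 0" using k by (simp add: e0_def)
    \<comment> \<open>opposite monotonicity: \<open>f - c\<close> decreases and the tilt increases on \<open>(-\<infinity>, 0]\<close>, and both change sign at \<open>u0\<close>\<close>
    have pointwise: "f u * (k * exp (l * u) * w u) + e0 * (c * w u)
        \<le> c * (k * exp (l * u) * w u) + e0 * (f u * w u)" for u
    proof (cases "u \<le> 0")
      case True
      have "(f u - c) * (exp (l * u) - exp (l * u0)) \<le> 0"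
      proof (cases "u \<le> u0")
        case True
        then have "(- u0) ^ 4 \<le> (- u) ^ 4"
          using u0 by (intro power_mono) auto
        then have "f u \<ge> c" using u0 by (simp add: f_def)
        moreover have "exp (l * u) \<le> exp (l * u0)" using True l by (simp add: mult_left_mono)
        ultimately show ?thesis by (intro mult_nonneg_nonpos) auto
      next
        case False
        then have "(- u) ^ 4 \<le> (- u0) ^ 4"
          using \<open>u \<le> 0\<close> by (intro power_mono) auto
        then have "f u \<le> c" using u0 by (simp add: f_def)
        moreover have "exp (l * u) \<ge> exp (l * u0)" using False l by (simp add: mult_left_mono)
        ultimately show ?thesis by (intro mult_nonpos_nonneg) auto
      qed
      then have "(f u - c) * (exp (l * u) - exp (l * u0)) * (k * w u) \<le> 0"
        by (rule mult_nonpos_nonneg) (use k w_nonneg in auto)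
      then show ?thesis by (simp add: e0_def algebra_simps)
    qed (simp add: w_def)
    have B_nn: "(\<integral>\<^sup>+u. ennreal (e0 * (c * w u)) \<partial>lborel) = ennreal (e0 * A)"
      using c e0 w_nonneg w_int by (subst nn_integral_eq_integral) (auto simp: A_eq B_def)
    have A_nn: "(\<integral>\<^sup>+u. ennreal (e0 * (f u * w u)) \<partial>lborel) = ennreal (e0 * A)"
      using f_ge e0 w_nonneg fw_int
      by (subst nn_integral_eq_integral) (auto simp: A_def intro!: mult_nonneg_nonneg order_trans[OF _ f_ge])
    let ?E = "\<lambda>u. k * exp (l * u) * w u"
    have E: "?E u \<ge> 0" for u using k w_nonneg by simp
    have f0: "f u \<ge> 0" for u using f_ge[of u] by linarith
    have "(\<integral>\<^sup>+u. ennreal (f u * ?E u) \<partial>lborel) + ennreal (e0 * A)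
        = (\<integral>\<^sup>+u. ennreal (f u * ?E u + e0 * (c * w u)) \<partial>lborel)"
      unfolding B_nn[symmetric] using E f0 e0 c w_nonneg
      by (subst nn_integral_add[symmetric]) (auto intro!: nn_integral_cong ennreal_plus[symmetric])
    also have "\<dots> \<le> (\<integral>\<^sup>+u. ennreal (c * ?E u + e0 * (f u * w u)) \<partial>lborel)"
      by (intro nn_integral_mono ennreal_leI pointwise)
    also have "\<dots> = (\<integral>\<^sup>+u. ennreal c * ennreal (1 * ?E u) \<partial>lborel) + ennreal (e0 * A)"
      unfolding A_nn[symmetric] using E f0 e0 c w_nonneg
      by (subst nn_integral_add[symmetric]) (auto intro!: nn_integral_cong simp: ennreal_mult[symmetric])
    also have "(\<integral>\<^sup>+u. ennreal c * ennreal (1 * ?E u) \<partial>lborel) = ennreal c * (\<integral>\<^sup>+u. ennreal (1 * ?E u) \<partial>lborel)"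
      by (rule nn_integral_cmult) measurable
    finally have "(\<integral>\<^sup>+u. ennreal (f u * ?E u) \<partial>lborel) \<le> ennreal c * (\<integral>\<^sup>+u. ennreal (1 * ?E u) \<partial>lborel)"
      by (simp add: add.commute ennreal_add_left_cancel_le)
    then show ?thesis
      using change[of f] change[of "\<lambda>_. 1"] f0 by (simp add: f_def cong: if_cong)
  qed
  with c show thesis by (rule that)
qed

section \<open>Overshoot, recurrence and the ladder height\<close>

lemma stopped_mono:
  assumes "\<And>u. u \<le> 0 \<Longrightarrow> f u \<le> g u"
  shows "stopped \<delta> n f z \<omega> \<le> stopped \<delta> n g z \<omega>"
  unfolding stopped_def using assms by (intro sum_mono) auto

lemma stopped_one: "stopped \<delta> n (\<lambda>_. 1) z \<omega> = (if alive \<delta> n z \<omega> then 0 else 1)"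
  by (induction n) (auto simp: stopped_def alive_def less_Suc_eq not_less)

lemma stopped_incseq: "incseq (\<lambda>n. stopped \<delta> n f z \<omega>)"
  by (rule incseq_SucI) (simp add: stopped_def)

lemma alive_anti_drift:
  assumes "\<delta> \<ge> 0" "alive \<delta> n z \<omega>" shows "alive 0 n z \<omega>"
  unfolding alive_def
proof (intro allI impI)
  fix k assume "k < n"
  with assms(2) have "z + position \<delta> \<omega> (Suc k) > 0" by (simp add: alive_def)
  moreover have "position \<delta> \<omega> (Suc k) \<le> position 0 \<omega> (Suc k)"
    using assms(1) by (subst position_drift) simp
  ultimately show "z + position 0 \<omega> (Suc k) > 0" by linarith
qed

text \<open>A bound on the overshoot of a single killing step passes to the walk: the position after the last step is
  a mixture, over the height before it, of steps conditioned to jump below 0.\<close>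

lemma overshoot_moment:
  assumes step: "\<And>z. z \<ge> 0 \<Longrightarrow>
      (\<integral>\<^sup>+s. (if z + s - \<delta> / 2 \<le> 0 then f (z + s - \<delta> / 2) else 0) \<partial>gauss)
      \<le> c * (\<integral>\<^sup>+s. (if z + s - \<delta> / 2 \<le> 0 then 1 else 0) \<partial>gauss)"
    and [measurable]: "f \<in> borel_measurable borel"
    and "z \<ge> 0"
  shows "(\<integral>\<^sup>+\<omega>. stopped \<delta> n f z \<omega> \<partial>paths) \<le> c * (\<integral>\<^sup>+\<omega>. (if alive \<delta> n z \<omega> then 0 else 1) \<partial>paths)"
  unfolding stopped_one[symmetric] using \<open>z \<ge> 0\<close>
proof (induction n arbitrary: z)
  case 0
  then show ?case by (simp add: stopped_def)
next
  case (Suc n)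
  let ?z = "\<lambda>s. z + s - \<delta> / 2"
  let ?V = "\<lambda>f z. \<integral>\<^sup>+\<omega>. stopped \<delta> n f z \<omega> \<partial>paths"
  have split: "(\<integral>\<^sup>+s. (if ?z s \<le> 0 then g (?z s) else ?V g (?z s)) \<partial>gauss)
      = (\<integral>\<^sup>+s. (if ?z s \<le> 0 then g (?z s) else 0) \<partial>gauss) + (\<integral>\<^sup>+s. (if ?z s \<le> 0 then 0 else ?V g (?z s)) \<partial>gauss)"
    if [measurable]: "g \<in> borel_measurable borel" for g
    by (subst nn_integral_add[symmetric]) (auto intro!: nn_integral_cong)
  have "(\<integral>\<^sup>+s. (if ?z s \<le> 0 then 0 else ?V f (?z s)) \<partial>gauss)
      \<le> (\<integral>\<^sup>+s. c * (if ?z s \<le> 0 then 0 else ?V (\<lambda>_. 1) (?z s)) \<partial>gauss)"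
    using Suc.IH by (intro nn_integral_mono) auto
  also have "\<dots> = c * (\<integral>\<^sup>+s. (if ?z s \<le> 0 then 0 else ?V (\<lambda>_. 1) (?z s)) \<partial>gauss)"
    by (rule nn_integral_cmult) measurable
  finally have "(\<integral>\<^sup>+s. (if ?z s \<le> 0 then f (?z s) else 0) \<partial>gauss) + (\<integral>\<^sup>+s. (if ?z s \<le> 0 then 0 else ?V f (?z s)) \<partial>gauss)
      \<le> c * (\<integral>\<^sup>+s. (if ?z s \<le> 0 then 1 else 0) \<partial>gauss) + c * (\<integral>\<^sup>+s. (if ?z s \<le> 0 then 0 else ?V (\<lambda>_. 1) (?z s)) \<partial>gauss)"
    by (rule add_mono[OF step[OF Suc.prems]])
  then show ?case
    using split[OF assms(2)] split[of "\<lambda>_. 1"]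
    by (simp add: expected_stopped_first_step distrib_left del: distrib_left_numeral)
qed

lemma sets_paths_Collect: "Measurable.pred paths P \<Longrightarrow> {\<omega>. P \<omega>} \<in> sets paths"
  by (simp add: pred_def)

lemma position_comb_seq:
  "position 0 (comb_seq n \<omega> \<omega>') (n + m) = position 0 \<omega> n + position 0 \<omega>' m"
proof -
  have "position 0 (comb_seq n \<omega> \<omega>') (n + m) = (\<Sum>i<n. comb_seq n \<omega> \<omega>' i) + (\<Sum>i=n..<n+m. comb_seq n \<omega> \<omega>' i)"
    by (simp add: position_def sum.atLeastLessThan_concat lessThan_atLeast0)
  also have "(\<Sum>i<n. comb_seq n \<omega> \<omega>' i) = position 0 \<omega> n"
    by (simp add: position_def comb_seq_def)
  also have "(\<Sum>i=n..<n+m. comb_seq n \<omega> \<omega>' i) = position 0 \<omega>' m"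
    by (simp add: position_def comb_seq_def sum.shift_bounds_nat_ivl[of _ 0 n m, simplified] lessThan_atLeast0 add.commute[of n])
  finally show ?thesis .
qed

lemma position_comb_seq_le:
  assumes "k \<le> n" shows "position 0 (comb_seq n \<omega> \<omega>') k = position 0 \<omega> k"
  using assms by (auto simp: position_def comb_seq_def intro!: sum.cong)

lemma gauss_tail_less_1: "measure gauss {-1<..} < 1"
proof -
  have "0 < std_normal_density 2" by (rule normal_density_pos) simp
  then have "0 < ennreal (std_normal_density 2) * emeasure lborel {-2..-1::real}"
    by simp
  also have "\<dots> = (\<integral>\<^sup>+s. ennreal (std_normal_density 2) * indicator {-2..-1::real} s \<partial>lborel)"
    by (rule nn_integral_cmult_indicator[symmetric]) simp
  also have "\<dots> \<le> (\<integral>\<^sup>+s. ennreal (std_normal_density s) * indicator {..-1} s \<partial>lborel)"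
  proof (intro nn_integral_mono)
    fix s :: real
    have "s\<^sup>2 \<le> 2\<^sup>2" if "-2 \<le> s" "s \<le> -1"
      using power_mono[of "-s" 2 2] that by simp
    then show "ennreal (std_normal_density 2) * indicator {-2..-1} s \<le> ennreal (std_normal_density s) * indicator {..-1} s"
      by (auto simp: indicator_def std_normal_density_def intro!: ennreal_leI divide_right_mono)
  qed
  also have "\<dots> = emeasure gauss {..-1}"
    unfolding gauss_def by (rule emeasure_density[symmetric]) auto
  finally have "0 < measure gauss {..-1}"
    by (simp add: gauss.emeasure_eq_measure)
  moreover have "{-1<..} = UNIV - {..-1::real}" by auto
  ultimately show ?thesis
    using gauss.prob_compl[of "{..-1}"] by simp
qed

text \<open>The driftless walk does not stay positive. Restarting at time \<open>n\<close>, survival up to time \<open>n + m\<close> requires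
  survival up to \<open>n\<close> and then either an increment above \<open>-sqrt m\<close>, whose probability \<open>q < 1\<close> does not depend
  on \<open>m\<close>, or a height above \<open>sqrt m\<close> at time \<open>n\<close>, which is unlikely for large \<open>m\<close>. Hence the limit \<open>p\<close>
  satisfies \<open>p \<le> p q\<close>.\<close>

lemma alive_probability_tendsto_0: "(\<lambda>n. measure paths {\<omega>. alive 0 n z \<omega>}) \<longlonglongrightarrow> 0"
proof -
  define a where "a n = measure paths {\<omega>. alive 0 n z \<omega>}" for n
  define t where "t n m = measure paths {\<omega>. z + position 0 \<omega> n > sqrt (real m)}" for n m
  define q where "q = measure gauss {-1<..}"
  have meas_a [measurable]: "{\<omega>. alive 0 n z \<omega>} \<in> sets paths" for n
    by (rule sets_paths_Collect) measurable
  have meas_t [measurable]: "{\<omega>. z + position 0 \<omega> n > sqrt (real m)} \<in> sets paths" for n m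
    by (rule sets_paths_Collect) measurable
  have [measurable]: "{\<omega>. position 0 \<omega> m > - sqrt (real m)} \<in> sets paths" for m
    by (rule sets_paths_Collect) measurable
  have dec: "a (n + m) \<le> a n * q + t n m" if "m > 0" for n m
  proof -
    have "ennreal (a (n + m)) = (\<integral>\<^sup>+\<omega>. indicator {\<omega>. alive 0 (n + m) z \<omega>} \<omega> \<partial>paths)"
      by (simp add: a_def paths.emeasure_eq_measure)
    also have "\<dots> = (\<integral>\<^sup>+\<omega>. indicator {\<omega>. alive 0 (n + m) z \<omega>} \<omega>
         \<partial>distr (paths \<Otimes>\<^sub>M paths) paths (\<lambda>(\<omega>, \<omega>'). comb_seq n \<omega> \<omega>'))"
      by (simp add: path_space.PiM_comb_seq)
    also have "\<dots> = (\<integral>\<^sup>+p. indicator {\<omega>. alive 0 (n + m) z \<omega>} (case p of (\<omega>, \<omega>') \<Rightarrow> comb_seq n \<omega> \<omega>') \<partial>(paths \<Otimes>\<^sub>M paths))"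
      by (rule nn_integral_distr) (auto intro: measurable_comb_seq)
    also have "\<dots> \<le> (\<integral>\<^sup>+p. indicator {\<omega>. alive 0 n z \<omega>} (fst p) * indicator {\<omega>. position 0 \<omega> m > - sqrt (real m)} (snd p)
        + indicator {\<omega>. z + position 0 \<omega> n > sqrt (real m)} (fst p) \<partial>(paths \<Otimes>\<^sub>M paths))"
    proof (intro nn_integral_mono)
      fix p :: "(nat \<Rightarrow> real) \<times> (nat \<Rightarrow> real)"
      obtain \<omega> \<omega>' where p: "p = (\<omega>, \<omega>')" by (cases p)
      have "alive 0 n z \<omega> \<and> (position 0 \<omega>' m > - sqrt (real m) \<or> z + position 0 \<omega> n > sqrt (real m))"
        if *: "alive 0 (n + m) z (comb_seq n \<omega> \<omega>')"
      proof
        show "alive 0 n z \<omega>"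
          using * unfolding alive_def by (metis Suc_leI position_comb_seq_le trans_less_add1)
        have "z + position 0 (comb_seq n \<omega> \<omega>') (Suc (n + m - 1)) > 0"
          using * \<open>m > 0\<close> unfolding alive_def by (meson add_gr_0 diff_less zero_less_one)
        then have "z + (position 0 \<omega> n + position 0 \<omega>' m) > 0"
          using \<open>m > 0\<close> by (simp add: position_comb_seq)
        then show "position 0 \<omega>' m > - sqrt (real m) \<or> z + position 0 \<omega> n > sqrt (real m)"
          by linarith
      qed
      then show "indicator {\<omega>. alive 0 (n + m) z \<omega>} (case p of (\<omega>, \<omega>') \<Rightarrow> comb_seq n \<omega> \<omega>')
        \<le> (indicator {\<omega>. alive 0 n z \<omega>} (fst p) * indicator {\<omega>. position 0 \<omega> m > - sqrt (real m)} (snd p)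
        + indicator {\<omega>. z + position 0 \<omega> n > sqrt (real m)} (fst p) :: ennreal)"
        by (auto simp: p indicator_def)
    qed
    also have "\<dots> = emeasure paths {\<omega>. alive 0 n z \<omega>} * emeasure paths {\<omega>. position 0 \<omega> m > - sqrt (real m)}
        + emeasure paths {\<omega>. z + position 0 \<omega> n > sqrt (real m)}"
      by (subst paths.nn_integral_fst[symmetric])
         (simp_all add: nn_integral_add nn_integral_cmult nn_integral_multc paths.emeasure_space_1[simplified])
    also have "emeasure paths {\<omega>. position 0 \<omega> m > - sqrt (real m)} = (\<integral>\<^sup>+\<omega>. indicator {- sqrt (real m)<..} (position 0 \<omega> m) \<partial>paths)"
    proof -
      have "(\<integral>\<^sup>+\<omega>. indicator {- sqrt (real m)<..} (position 0 \<omega> m) \<partial>paths)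
          = (\<integral>\<^sup>+\<omega>. indicator {\<omega>. position 0 \<omega> m > - sqrt (real m)} \<omega> \<partial>paths)"
        by (intro nn_integral_cong) (simp add: indicator_def)
      then show ?thesis by simp
    qed
    also have "\<dots> = (\<integral>\<^sup>+s. indicator {- sqrt (real m)<..} (sqrt (real m) * s) \<partial>gauss)"
      by (rule nn_integral_position[OF that]) simp
    also have "\<dots> = (\<integral>\<^sup>+s. indicator {-1<..} s \<partial>gauss)"
    proof (intro nn_integral_cong)
      fix s
      have "- sqrt (real m) < sqrt (real m) * s \<longleftrightarrow> -1 < s"
        using mult_less_cancel_left_pos[of "sqrt (real m)" "-1" s] that by simp
      then show "indicator {- sqrt (real m)<..} (sqrt (real m) * s) = (indicator {-1<..} s :: ennreal)"
        by (simp add: indicator_def)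
    qed
    also have "\<dots> = ennreal q"
      by (simp add: q_def gauss.emeasure_eq_measure)
    finally have "ennreal (a (n + m)) \<le> ennreal (a n * q + t n m)"
      by (simp add: a_def t_def q_def paths.emeasure_eq_measure ennreal_mult ennreal_plus)
    then show ?thesis
      by (subst (asm) ennreal_le_iff) (auto simp: a_def q_def t_def)
  qed
  have t0: "(\<lambda>m. t n m) \<longlonglongrightarrow> 0" for n
  proof -
    have "(\<lambda>m. t n m) \<longlonglongrightarrow> measure paths (\<Inter>m. {\<omega>. z + position 0 \<omega> n > sqrt (real m)})"
      unfolding t_def
      by (rule paths.finite_Lim_measure_decseq)
         (auto simp: decseq_def, metis of_nat_le_iff order.strict_trans1 real_sqrt_le_iff)
    moreover have "(\<Inter>m. {\<omega>. z + position 0 \<omega> n > sqrt (real m)}) = {}"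
    proof -
      have "\<exists>m. z + position 0 \<omega> n \<le> sqrt (real m)" for \<omega>
      proof -
        obtain m :: nat where "\<bar>z + position 0 \<omega> n\<bar> \<le> real m" using real_arch_simple by blast
        then have "z + position 0 \<omega> n \<le> sqrt (real (m\<^sup>2))" by simp
        then show ?thesis by blast
      qed
      then show ?thesis by (auto simp flip: not_le)
    qed
    ultimately show ?thesis by simp
  qed
  have "decseq a"
    unfolding a_def decseq_def
    by (auto intro!: paths.finite_measure_mono simp: alive_def)
  then obtain p where p: "a \<longlonglongrightarrow> p" "\<And>n. p \<le> a n"
    by (rule decseq_convergent[of a 0]) (auto simp: a_def)
  have "p \<le> a n * q" for n
  proof (rule LIMSEQ_le)
    show "(\<lambda>m. a (m + n)) \<longlonglongrightarrow> p" using p(1) by (rule LIMSEQ_ignore_initial_segment)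
    show "(\<lambda>m. a n * q + t n m) \<longlonglongrightarrow> a n * q"
      using tendsto_add[OF tendsto_const t0[of n], of "a n * q"] by simp
    show "\<exists>N. \<forall>m\<ge>N. a (m + n) \<le> a n * q + t n m"
      using dec[of _ n] by (intro exI[of _ 1]) (auto simp: add.commute)
  qed
  then have "p \<le> p * q"
    using tendsto_mult_right[OF p(1), of q] by (intro LIMSEQ_le_const) auto
  moreover have "p \<ge> 0" by (rule LIMSEQ_le_const[OF p(1)]) (auto simp: a_def)
  ultimately have "p = 0"
    using gauss_tail_less_1 by (simp add: q_def mult_le_cancel_left1)
  with p(1) show ?thesis by (simp add: a_def[abs_def])
qed

lemma AE_reaches_below: "AE \<omega> in paths. \<exists>k. position 0 \<omega> (Suc k) \<le> 0"
proof -
  have meas: "{\<omega>. alive 0 n 0 \<omega>} \<in> sets paths" for n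
    by (rule sets_paths_Collect) measurable
  let ?N = "{\<omega>. \<forall>k. position 0 \<omega> (Suc k) > 0}"
  have N: "?N \<in> sets paths"
    by (rule sets_paths_Collect) measurable
  have "measure paths ?N \<le> measure paths {\<omega>. alive 0 n 0 \<omega>}" for n
    by (rule paths.finite_measure_mono[OF _ meas]) (auto simp: alive_def)
  then have "measure paths ?N \<le> 0"
    using alive_probability_tendsto_0[of 0] by (intro LIMSEQ_le_const) auto
  then have "emeasure paths ?N = 0"
    by (simp add: paths.emeasure_eq_measure measure_le_0_iff)
  then have "AE \<omega> in paths. \<omega> \<notin> ?N"
    using N by (intro AE_not_in) (auto simp: null_sets_def)
  then show ?thesis by eventually_elim (auto simp: not_less)
qed

text \<open>The driftless walk almost surely never hits 0 exactly. This keeps the first passage below 0 stable under a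
  small change of the drift.\<close>

lemma AE_position_nonzero: "AE \<omega> in paths. \<forall>k. position 0 \<omega> (Suc k) \<noteq> 0"
proof (rule AE_all_countable[THEN iffD2], rule allI)
  fix k
  have "AE s in gauss. s \<noteq> 0"
    unfolding gauss_def using AE_lborel_singleton[of "0::real"] by (auto simp: AE_density elim: eventually_mono)
  then have "AE s in distr paths lborel (\<lambda>\<omega>. position 0 \<omega> (Suc k) / sqrt (real (Suc k))). s \<noteq> 0"
    by (simp only: distr_position[of "Suc k", OF zero_less_Suc])
  then have "AE \<omega> in paths. position 0 \<omega> (Suc k) / sqrt (real (Suc k)) \<noteq> 0"
    by (subst (asm) AE_distr_iff) auto
  then show "AE \<omega> in paths. position 0 \<omega> (Suc k) \<noteq> 0" by simp
qed

definition ladder_time :: "real \<Rightarrow> (nat \<Rightarrow> real) \<Rightarrow> nat" where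
  "ladder_time \<delta> \<omega> = Inf {n. n > 0 \<and> position \<delta> \<omega> n \<le> 0}"

text \<open>Descending steps are counted as positive heights. On paths that never return to \<open>(-\<infinity>, 0]\<close> the value is
  arbitrary; those paths form a null set.\<close>

definition ladder_height :: "real \<Rightarrow> (nat \<Rightarrow> real) \<Rightarrow> real" where
  "ladder_height \<delta> \<omega> = - position \<delta> \<omega> (ladder_time \<delta> \<omega>)"

lemma measurable_ladder_height [measurable]: "ladder_height \<delta> \<in> borel_measurable paths"
proof -
  have [measurable]: "ladder_time \<delta> \<in> measurable paths (count_space UNIV)"
    unfolding ladder_time_def Inf_nat_def by measurable
  show ?thesis
    unfolding ladder_height_def
    by (rule borel_measurable_uminus, rule measurable_compose_countable[where f = "\<lambda>n \<omega>. position \<delta> \<omega> n"]) measurable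
qed

lemma ladder_time_eqI:
  assumes "position \<delta> \<omega> (Suc m) \<le> 0" "\<And>k. k < m \<Longrightarrow> position \<delta> \<omega> (Suc k) > 0"
  shows "ladder_time \<delta> \<omega> = Suc m"
  unfolding ladder_time_def Inf_nat_def
proof (rule Least_equality)
  fix n assume "n \<in> {n. n > 0 \<and> position \<delta> \<omega> n \<le> 0}"
  then obtain k where "n = Suc k" "position \<delta> \<omega> (Suc k) \<le> 0" by (cases n) auto
  with assms(2)[of k] show "Suc m \<le> n" by force
qed (use assms in auto)

lemma ladder_time_reached:
  assumes "\<exists>k. position \<delta> \<omega> (Suc k) \<le> 0"
  obtains m where "ladder_time \<delta> \<omega> = Suc m" "position \<delta> \<omega> (Suc m) \<le> 0"
    "\<And>k. k < m \<Longrightarrow> position \<delta> \<omega> (Suc k) > 0"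
proof -
  define m where "m = (LEAST k. position \<delta> \<omega> (Suc k) \<le> 0)"
  have 1: "position \<delta> \<omega> (Suc m) \<le> 0"
    unfolding m_def using assms by (rule LeastI_ex)
  have 2: "position \<delta> \<omega> (Suc k) > 0" if "k < m" for k
    using not_less_Least[of k "\<lambda>k. position \<delta> \<omega> (Suc k) \<le> 0"] that by (auto simp: m_def)
  show thesis
    using that ladder_time_eqI[OF 1 2] 1 2 by blast
qed

lemma AE_reaches_below_drift:
  assumes "\<delta> \<ge> 0" shows "AE \<omega> in paths. \<exists>k. position \<delta> \<omega> (Suc k) \<le> 0"
  using AE_reaches_below
proof eventually_elim
  case (elim \<omega>)
  then obtain k where "position 0 \<omega> (Suc k) \<le> 0" by blast
  moreover have "position \<delta> \<omega> (Suc k) \<le> position 0 \<omega> (Suc k)"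
    using assms by (subst position_drift) simp
  ultimately show ?case by (intro exI[of _ k]) linarith
qed

lemma stopped_ladder:
  assumes "ladder_time \<delta> \<omega> = Suc m" "position \<delta> \<omega> (Suc m) \<le> 0"
    "\<And>k. k < m \<Longrightarrow> position \<delta> \<omega> (Suc k) > 0"
  shows "stopped \<delta> n f 0 \<omega> = (if m < n then f (- ladder_height \<delta> \<omega>) else 0)"
proof -
  have "(alive \<delta> k 0 \<omega> \<and> 0 + position \<delta> \<omega> (Suc k) \<le> 0) \<longleftrightarrow> k = m" for k
    using assms(2,3) unfolding alive_def by (metis add_0 linorder_neqE_nat not_le)
  then have "stopped \<delta> n f 0 \<omega> = (\<Sum>k<n. if k = m then f (position \<delta> \<omega> (Suc m)) else 0)"
    unfolding stopped_def by (intro sum.cong) auto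
  then show ?thesis
    using assms(1) by (simp add: ladder_height_def)
qed

lemma expected_stopped_tendsto:
  assumes "\<delta> \<ge> 0" and [measurable]: "f \<in> borel_measurable borel"
  shows "(\<lambda>n. \<integral>\<^sup>+\<omega>. stopped \<delta> n f 0 \<omega> \<partial>paths) \<longlonglongrightarrow> (\<integral>\<^sup>+\<omega>. f (- ladder_height \<delta> \<omega>) \<partial>paths)"
proof -
  have inc: "incseq (\<lambda>n. stopped \<delta> n f 0)"
    using stopped_incseq by (auto simp: incseq_def le_fun_def)
  have "(\<lambda>n. \<integral>\<^sup>+\<omega>. stopped \<delta> n f 0 \<omega> \<partial>paths) \<longlonglongrightarrow> (SUP n. \<integral>\<^sup>+\<omega>. stopped \<delta> n f 0 \<omega> \<partial>paths)"
    using inc by (intro LIMSEQ_SUP) (auto simp: incseq_def le_fun_def intro!: nn_integral_mono)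
  also have "(SUP n. \<integral>\<^sup>+\<omega>. stopped \<delta> n f 0 \<omega> \<partial>paths) = (\<integral>\<^sup>+\<omega>. (SUP n. stopped \<delta> n f 0 \<omega>) \<partial>paths)"
    using inc by (intro nn_integral_monotone_convergence_SUP[symmetric]) auto
  also have "\<dots> = (\<integral>\<^sup>+\<omega>. f (- ladder_height \<delta> \<omega>) \<partial>paths)"
  proof (rule nn_integral_cong_AE)
    show "AE \<omega> in paths. (SUP n. stopped \<delta> n f 0 \<omega>) = f (- ladder_height \<delta> \<omega>)"
      using AE_reaches_below_drift[OF assms(1)]
    proof eventually_elim
      case (elim \<omega>)
      then obtain m where "ladder_time \<delta> \<omega> = Suc m" "position \<delta> \<omega> (Suc m) \<le> 0"
          "\<And>k. k < m \<Longrightarrow> position \<delta> \<omega> (Suc k) > 0"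
        by (rule ladder_time_reached) blast
      note * = stopped_ladder[OF this]
      show ?case
        by (intro antisym SUP_least SUP_upper2[of "Suc m"]) (auto simp: *)
    qed
  qed
  finally show ?thesis .
qed

lemma ladder_height_nonneg:
  assumes "\<delta> \<ge> 0" shows "AE \<omega> in paths. 0 \<le> ladder_height \<delta> \<omega>"
  using AE_reaches_below_drift[OF assms]
proof eventually_elim
  case (elim \<omega>)
  then show ?case
    by (rule ladder_time_reached) (simp add: ladder_height_def)
qed

text \<open>A bounded function that is harmonic above a level is reproduced by its value at the first ladder point below
  the level. The boundedness makes the contribution of surviving paths vanish in the limit. This replaces
  the strong Markov property at the ladder time.\<close>

lemma harmonic_ladder:
  assumes "\<delta> \<ge> 0" and v [measurable]: "v \<in> borel_measurable borel"
    and harmonic: "\<And>z. z \<ge> 0 \<Longrightarrow> v z = (\<integral>\<^sup>+s. v (z + s - \<delta> / 2) \<partial>gauss)"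
    and bounded: "\<And>z. z \<ge> 0 \<Longrightarrow> v z \<le> ennreal C"
  shows "v 0 = (\<integral>\<^sup>+\<omega>. v (- ladder_height \<delta> \<omega>) \<partial>paths)"
proof (rule antisym)
  let ?V = "\<lambda>n. \<integral>\<^sup>+\<omega>. stopped \<delta> n v 0 \<omega> \<partial>paths"
  have lim: "?V \<longlonglongrightarrow> (\<integral>\<^sup>+\<omega>. v (- ladder_height \<delta> \<omega>) \<partial>paths)"
    by (rule expected_stopped_tendsto) fact+
  have os: "v 0 = ?V n + (\<integral>\<^sup>+\<omega>. (if alive \<delta> n 0 \<omega> then v (0 + position \<delta> \<omega> n) else 0) \<partial>paths)" for n
    by (rule optional_stopping[OF v]) (rule harmonic; simp)+
  have "?V n \<le> v 0" for n using add_increasing2[OF zero_le order_refl] by (rule ord_le_eq_trans) (rule os[symmetric])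
  then show "(\<integral>\<^sup>+\<omega>. v (- ladder_height \<delta> \<omega>) \<partial>paths) \<le> v 0"
    by (intro LIMSEQ_le_const2[OF lim]) auto
  have [measurable]: "{\<omega>. alive 0 n 0 \<omega>} \<in> sets paths" for n
    by (rule sets_paths_Collect) measurable
  have upper: "v 0 \<le> ?V n + ennreal C * ennreal (measure paths {\<omega>. alive 0 n 0 \<omega>})" for n
  proof -
    have "(\<integral>\<^sup>+\<omega>. (if alive \<delta> n 0 \<omega> then v (0 + position \<delta> \<omega> n) else 0) \<partial>paths)
        \<le> (\<integral>\<^sup>+\<omega>. ennreal C * indicator {\<omega>. alive 0 n 0 \<omega>} \<omega> \<partial>paths)"
    proof (intro nn_integral_mono)
      fix \<omega>
      have "position \<delta> \<omega> n \<ge> 0" if "alive \<delta> n 0 \<omega>"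
      proof (cases n)
        case (Suc m)
        with that have "0 + position \<delta> \<omega> (Suc m) > 0" unfolding alive_def by blast
        then show ?thesis using Suc by simp
      qed simp
      then show "(if alive \<delta> n 0 \<omega> then v (0 + position \<delta> \<omega> n) else 0) \<le> ennreal C * indicator {\<omega>. alive 0 n 0 \<omega>} \<omega>"
        using bounded alive_anti_drift[OF assms(1)] by (auto simp: indicator_def)
    qed
    also have "\<dots> = ennreal C * ennreal (measure paths {\<omega>. alive 0 n 0 \<omega>})"
      by (simp add: nn_integral_cmult paths.emeasure_eq_measure)
    finally show ?thesis
      by (intro ord_eq_le_trans[OF os[of n]] add_left_mono)
  qed
  have "(\<lambda>n. ?V n + ennreal C * ennreal (measure paths {\<omega>. alive 0 n 0 \<omega>}))
      \<longlonglongrightarrow> (\<integral>\<^sup>+\<omega>. v (- ladder_height \<delta> \<omega>) \<partial>paths) + ennreal C * ennreal 0"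
    by (intro tendsto_add lim ennreal_tendsto_cmult tendsto_ennrealI alive_probability_tendsto_0) simp
  then show "v 0 \<le> (\<integral>\<^sup>+\<omega>. v (- ladder_height \<delta> \<omega>) \<partial>paths)"
    by (simp add: LIMSEQ_le_const[where a = "v 0"] upper)
qed

section \<open>Moments of the ladder height\<close>

lemma overshoot_constant:
  "\<exists>c\<ge>1. \<forall>\<delta> z n. 0 \<le> \<delta> \<longrightarrow> \<delta> \<le> 1 \<longrightarrow> 0 \<le> z \<longrightarrow>
    (\<integral>\<^sup>+\<omega>. stopped \<delta> n (\<lambda>u. ennreal (1 + u ^ 4)) z \<omega> \<partial>paths)
      \<le> ennreal c * (\<integral>\<^sup>+\<omega>. (if alive \<delta> n z \<omega> then 0 else 1) \<partial>paths)"
proof -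
  obtain c :: real where c: "c \<ge> 1"
    and "\<And>z \<delta>. z \<ge> 0 \<Longrightarrow> \<delta> \<le> 1 \<Longrightarrow>
      (\<integral>\<^sup>+s. (if z + s - \<delta> / 2 \<le> 0 then ennreal (1 + (z + s - \<delta> / 2) ^ 4) else 0) \<partial>gauss)
      \<le> ennreal c * (\<integral>\<^sup>+s. (if z + s - \<delta> / 2 \<le> 0 then 1 else 0) \<partial>gauss)"
    by (rule overshoot_bound) blast
  then show ?thesis
    by (intro exI[of _ c] conjI c allI impI overshoot_moment) auto
qed

text \<open>Uniformity in the drift, including drift 0, is what turns almost sure convergence of ladder heights into
  convergence of their first two moments.\<close>

lemma ladder_moment_bound:
  "\<exists>c. \<forall>\<delta>. 0 \<le> \<delta> \<longrightarrow> \<delta> \<le> 1 \<longrightarrow> integrable paths (\<lambda>\<omega>. ladder_height \<delta> \<omega> ^ 4)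
     \<and> (\<integral>\<omega>. ladder_height \<delta> \<omega> ^ 4 \<partial>paths) \<le> c"
proof -
  obtain c :: real where c: "c \<ge> 1" and bound: "\<And>\<delta> z n. 0 \<le> \<delta> \<Longrightarrow> \<delta> \<le> 1 \<Longrightarrow> 0 \<le> z \<Longrightarrow>
    (\<integral>\<^sup>+\<omega>. stopped \<delta> n (\<lambda>u. ennreal (1 + u ^ 4)) z \<omega> \<partial>paths)
      \<le> ennreal c * (\<integral>\<^sup>+\<omega>. (if alive \<delta> n z \<omega> then 0 else 1) \<partial>paths)"
    using overshoot_constant by blast
  show ?thesis
  proof (intro exI[of _ c] allI impI)
    fix \<delta> :: real assume \<delta>: "0 \<le> \<delta>" "\<delta> \<le> 1"
    have le: "(\<integral>\<^sup>+\<omega>. stopped \<delta> n (\<lambda>u. ennreal (1 + u ^ 4)) 0 \<omega> \<partial>paths) \<le> ennreal c" for n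
    proof -
      have "(\<integral>\<^sup>+\<omega>. (if alive \<delta> n 0 \<omega> then 0 else 1) \<partial>paths) \<le> (\<integral>\<^sup>+\<omega>. 1 \<partial>paths)"
        by (intro nn_integral_mono) auto
      then have "(\<integral>\<^sup>+\<omega>. (if alive \<delta> n 0 \<omega> then 0 else 1) \<partial>paths) \<le> 1"
        by (simp add: paths.emeasure_space_1[simplified])
      then have "ennreal c * (\<integral>\<^sup>+\<omega>. (if alive \<delta> n 0 \<omega> then 0 else 1) \<partial>paths) \<le> ennreal c * 1"
        by (rule mult_left_mono) simp
      then show ?thesis
        using bound[OF \<delta> order_refl, of n] by simp
    qed
    have lim: "(\<lambda>n. \<integral>\<^sup>+\<omega>. stopped \<delta> n (\<lambda>u. ennreal (1 + u ^ 4)) 0 \<omega> \<partial>paths)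
        \<longlonglongrightarrow> (\<integral>\<^sup>+\<omega>. ennreal (1 + (- ladder_height \<delta> \<omega>) ^ 4) \<partial>paths)"
      using \<delta>(1) by (rule expected_stopped_tendsto) measurable
    have "(\<integral>\<^sup>+\<omega>. ennreal (1 + (- ladder_height \<delta> \<omega>) ^ 4) \<partial>paths) \<le> ennreal c"
      using le by (intro LIMSEQ_le_const2[OF lim]) auto
    then have *: "(\<integral>\<^sup>+\<omega>. ennreal (1 + ladder_height \<delta> \<omega> ^ 4) \<partial>paths) \<le> ennreal c"
      by simp
    have "(\<integral>\<^sup>+\<omega>. ennreal (ladder_height \<delta> \<omega> ^ 4) \<partial>paths) \<le> (\<integral>\<^sup>+\<omega>. ennreal (1 + ladder_height \<delta> \<omega> ^ 4) \<partial>paths)"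
      by (intro nn_integral_mono ennreal_leI) simp
    with * have **: "(\<integral>\<^sup>+\<omega>. ennreal (ladder_height \<delta> \<omega> ^ 4) \<partial>paths) \<le> ennreal c"
      by (rule order_trans[rotated])
    have int: "integrable paths (\<lambda>\<omega>. ladder_height \<delta> \<omega> ^ 4)"
      using ** by (intro integrableI_bounded) (auto simp: le_less_trans)
    moreover have "(\<integral>\<omega>. ladder_height \<delta> \<omega> ^ 4 \<partial>paths) \<le> c"
      using ** c by (subst (asm) nn_integral_eq_integral[OF int]) auto
    ultimately show "integrable paths (\<lambda>\<omega>. ladder_height \<delta> \<omega> ^ 4)
        \<and> (\<integral>\<omega>. ladder_height \<delta> \<omega> ^ 4 \<partial>paths) \<le> c" ..
  qed
qed

lemma abs_power_le_one_plus_quartic: "k \<le> 4 \<Longrightarrow> \<bar>x :: real\<bar> ^ k \<le> 1 + x ^ 4"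
proof (cases "\<bar>x\<bar> \<le> 1")
  case True
  then have "\<bar>x\<bar> ^ k \<le> 1" by (simp add: power_le_one)
  then show ?thesis by (simp add: add_increasing2)
next
  assume "k \<le> 4"
  case False
  then have "\<bar>x\<bar> ^ k \<le> \<bar>x\<bar> ^ 4" using \<open>k \<le> 4\<close> by (intro power_increasing) auto
  then show ?thesis by simp
qed

lemma integrable_ladder_height_power:
  assumes "0 \<le> \<delta>" "\<delta> \<le> 1" "k \<le> 4"
  shows "integrable paths (\<lambda>\<omega>. ladder_height \<delta> \<omega> ^ k)"
proof (rule Bochner_Integration.integrable_bound)
  show "integrable paths (\<lambda>\<omega>. 1 + ladder_height \<delta> \<omega> ^ 4)"
    using ladder_moment_bound assms by auto
qed (use abs_power_le_one_plus_quartic[OF assms(3)] in \<open>auto simp: power_abs\<close>)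

lemma integrable_ladder_height:
  "0 \<le> \<delta> \<Longrightarrow> \<delta> \<le> 1 \<Longrightarrow> integrable paths (ladder_height \<delta>)"
  using integrable_ladder_height_power[of \<delta> 1] by simp

text \<open>Bounded second moments give uniform integrability: clipping at level \<open>L\<close> changes each expectation by at most
  \<open>c / L\<close>, and the clipped variables converge by dominated convergence.\<close>

lemma (in prob_space) expectation_tendsto_of_second_moment:
  fixes Z :: "nat \<Rightarrow> 'a \<Rightarrow> real"
  assumes meas [measurable]: "\<And>n. Z n \<in> borel_measurable M" "Y \<in> borel_measurable M"
    and lim: "AE \<omega> in M. (\<lambda>n. Z n \<omega>) \<longlonglongrightarrow> Y \<omega>"
    and int: "\<And>n. integrable M (\<lambda>\<omega>. (Z n \<omega>)\<^sup>2)" "integrable M (\<lambda>\<omega>. (Y \<omega>)\<^sup>2)"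
    and bound: "\<And>n. expectation (\<lambda>\<omega>. (Z n \<omega>)\<^sup>2) \<le> c" "expectation (\<lambda>\<omega>. (Y \<omega>)\<^sup>2) \<le> c"
  shows "(\<lambda>n. expectation (Z n)) \<longlonglongrightarrow> expectation Y"
proof (rule LIMSEQ_I)
  fix \<epsilon> :: real assume \<epsilon>: "\<epsilon> > 0"
  have "0 \<le> expectation (\<lambda>\<omega>. (Y \<omega>)\<^sup>2)" by (rule integral_nonneg_AE) simp
  then have c: "c \<ge> 0" using bound(2) by linarith
  \<comment> \<open>at this level the two clipping errors together are at most \<open>\<epsilon>/2\<close>\<close>
  define L where "L = 4 * (c + 1) / \<epsilon>"
  have L: "L > 0" using c \<epsilon> by (simp add: L_def)
  define clip where "clip x = max (- L) (min L x)" for x :: real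
  have [measurable]: "clip \<in> borel_measurable borel"
    unfolding clip_def by measurable
  have clip_bound: "\<bar>clip x\<bar> \<le> L" for x using L by (auto simp: clip_def)
  have clip_err: "\<bar>x - clip x\<bar> \<le> x\<^sup>2 / L" for x
  proof (cases "\<bar>x\<bar> \<le> L")
    case True
    then have "clip x = x" by (auto simp: clip_def)
    then show ?thesis using L by simp
  next
    case False
    then have "\<bar>x - clip x\<bar> \<le> \<bar>x\<bar>" using L by (auto simp: clip_def)
    also have "\<bar>x\<bar> * L \<le> \<bar>x\<bar> * \<bar>x\<bar>" using False by (intro mult_left_mono) auto
    then have "\<bar>x\<bar> \<le> x\<^sup>2 / L" using L by (simp add: field_simps power2_eq_square)
    finally show ?thesis .
  qed
  have err: "\<bar>expectation W - expectation (\<lambda>\<omega>. clip (W \<omega>))\<bar> \<le> c / L"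
    if [measurable]: "W \<in> borel_measurable M" and W2: "integrable M (\<lambda>\<omega>. (W \<omega>)\<^sup>2)" "expectation (\<lambda>\<omega>. (W \<omega>)\<^sup>2) \<le> c" for W
  proof -
    have W: "integrable M W"
      using W2(1) by (rule square_integrable_imp_integrable[rotated]) measurable
    have cW: "integrable M (\<lambda>\<omega>. clip (W \<omega>))"
      by (rule integrable_const_bound[where B = L]) (use clip_bound in auto)
    have "expectation W - expectation (\<lambda>\<omega>. clip (W \<omega>)) = expectation (\<lambda>\<omega>. W \<omega> - clip (W \<omega>))"
      using W cW by simp
    also have "\<bar>\<dots>\<bar> \<le> expectation (\<lambda>\<omega>. \<bar>W \<omega> - clip (W \<omega>)\<bar>)"
      by (rule integral_abs_bound)
    also have "\<dots> \<le> expectation (\<lambda>\<omega>. (W \<omega>)\<^sup>2 / L)"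
      using W cW W2 by (intro integral_mono clip_err) auto
    also have "\<dots> \<le> c / L" using W2 L by (simp add: divide_right_mono)
    finally show ?thesis .
  qed
  have "(\<lambda>n. expectation (\<lambda>\<omega>. clip (Z n \<omega>))) \<longlonglongrightarrow> expectation (\<lambda>\<omega>. clip (Y \<omega>))"
  proof (rule integral_dominated_convergence[where w = "\<lambda>_. L"])
    show "AE \<omega> in M. (\<lambda>n. clip (Z n \<omega>)) \<longlonglongrightarrow> clip (Y \<omega>)"
      using lim by eventually_elim (unfold clip_def, intro tendsto_max tendsto_min tendsto_const)
  qed (use clip_bound in auto)
  from LIMSEQ_D[OF this, of "\<epsilon> / 2"] \<epsilon> obtain N where N: "\<And>n. n \<ge> N \<Longrightarrow>
    \<bar>expectation (\<lambda>\<omega>. clip (Z n \<omega>)) - expectation (\<lambda>\<omega>. clip (Y \<omega>))\<bar> < \<epsilon> / 2" by auto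
  have "c / L * 2 \<le> \<epsilon> / 2"
    using c \<epsilon> by (simp add: L_def field_simps)
  then have "norm (expectation (Z n) - expectation Y) < \<epsilon>" if "n \<ge> N" for n
    using N[OF that] err[OF meas(1) int(1) bound(1), of n] err[OF meas(2) int(2) bound(2)]
    unfolding real_norm_def by linarith
  then show "\<exists>N. \<forall>n\<ge>N. norm (expectation (Z n) - expectation Y) < \<epsilon>"
    by blast
qed

lemma position_tendsto_driftless: "((\<lambda>\<delta>. position \<delta> \<omega> n) \<longlongrightarrow> position 0 \<omega> n) (at_right 0)"
proof -
  have "((\<lambda>\<delta>. position 0 \<omega> n - real n * \<delta> / 2) \<longlongrightarrow> position 0 \<omega> n - real n * 0 / 2) (at_right 0)"
    by (intro tendsto_intros) auto
  moreover have "(\<lambda>\<delta>. position \<delta> \<omega> n) = (\<lambda>\<delta>. position 0 \<omega> n - real n * \<delta> / 2)"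
    by (rule ext) (rule position_drift)
  ultimately show ?thesis by simp
qed

text \<open>Along almost every path the ladder time is eventually constant as the drift vanishes, because the driftless
  walk is strictly positive before its ladder time and strictly negative at it.\<close>

lemma AE_ladder_height_tendsto:
  "AE \<omega> in paths. ((\<lambda>\<delta>. ladder_height \<delta> \<omega>) \<longlongrightarrow> ladder_height 0 \<omega>) (at_right 0) \<and> 0 < ladder_height 0 \<omega>"
  using AE_reaches_below AE_position_nonzero
proof eventually_elim
  case (elim \<omega>)
  obtain m where m: "ladder_time 0 \<omega> = Suc m" "position 0 \<omega> (Suc m) \<le> 0"
    "\<And>k. k < m \<Longrightarrow> position 0 \<omega> (Suc k) > 0"
    using elim(1) by (rule ladder_time_reached) blast
  have neg: "position 0 \<omega> (Suc m) < 0"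
    using m(2) elim(2) by (simp add: less_le)
  have "\<forall>\<^sub>F \<delta> in at_right 0. \<forall>k\<in>{..<m}. position \<delta> \<omega> (Suc k) > 0"
    using m(3) by (intro eventually_ball_finite ballI order_tendstoD(1)[OF position_tendsto_driftless]) auto
  moreover have "\<forall>\<^sub>F \<delta> in at_right 0. position \<delta> \<omega> (Suc m) < 0"
    by (rule order_tendstoD(2)[OF position_tendsto_driftless neg])
  ultimately have "\<forall>\<^sub>F \<delta> in at_right 0. - position \<delta> \<omega> (Suc m) = ladder_height \<delta> \<omega>"
  proof eventually_elim
    case (elim \<delta>)
    have "ladder_time \<delta> \<omega> = Suc m" by (rule ladder_time_eqI) (use elim in auto)
    then show ?case by (simp add: ladder_height_def)
  qed
  moreover have "((\<lambda>\<delta>. - position \<delta> \<omega> (Suc m)) \<longlongrightarrow> ladder_height 0 \<omega>) (at_right 0)"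
    unfolding ladder_height_def m(1) by (intro tendsto_minus position_tendsto_driftless)
  ultimately show ?case
    using neg by (auto simp: ladder_height_def m(1) intro: Lim_transform_eventually)
qed

lemma ladder_moment_tendsto:
  assumes "k = 1 \<or> k = 2"
  shows "((\<lambda>\<delta>. \<integral>\<omega>. ladder_height \<delta> \<omega> ^ k \<partial>paths) \<longlongrightarrow> (\<integral>\<omega>. ladder_height 0 \<omega> ^ k \<partial>paths)) (at_right 0)"
proof (rule tendsto_at_right_sequentially[of 0 1])
  fix S :: "nat \<Rightarrow> real"
  assume S: "\<And>n. 0 < S n" "\<And>n. S n < 1" "S \<longlonglongrightarrow> 0"
  obtain c where c: "\<And>\<delta>. 0 \<le> \<delta> \<Longrightarrow> \<delta> \<le> 1 \<Longrightarrow> (\<integral>\<omega>. ladder_height \<delta> \<omega> ^ 4 \<partial>paths) \<le> c"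
    using ladder_moment_bound by blast
  have int: "integrable paths (\<lambda>\<omega>. (ladder_height \<delta> \<omega> ^ k)\<^sup>2)"
      and bound: "(\<integral>\<omega>. (ladder_height \<delta> \<omega> ^ k)\<^sup>2 \<partial>paths) \<le> 1 + c" if \<delta>: "0 \<le> \<delta>" "\<delta> \<le> 1" for \<delta>
  proof -
    have k: "k * 2 \<le> 4" using assms by auto
    show *: "integrable paths (\<lambda>\<omega>. (ladder_height \<delta> \<omega> ^ k)\<^sup>2)"
      using integrable_ladder_height_power[OF \<delta> k] by (simp add: power_mult)
    have "(\<integral>\<omega>. (ladder_height \<delta> \<omega> ^ k)\<^sup>2 \<partial>paths) \<le> (\<integral>\<omega>. 1 + ladder_height \<delta> \<omega> ^ 4 \<partial>paths)"
    proof (rule integral_mono[OF *])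
      show "integrable paths (\<lambda>\<omega>. 1 + ladder_height \<delta> \<omega> ^ 4)"
        using integrable_ladder_height_power[OF \<delta>, of 4] by simp
      show "(ladder_height \<delta> \<omega> ^ k)\<^sup>2 \<le> 1 + ladder_height \<delta> \<omega> ^ 4" for \<omega>
        using abs_power_le_one_plus_quartic[OF k, of "ladder_height \<delta> \<omega>"] by (simp add: power_mult flip: power_abs)
    qed
    also have "\<dots> \<le> 1 + c"
      using integrable_ladder_height_power[OF \<delta>, of 4] c[OF \<delta>] by (simp add: paths.prob_space[simplified])
    finally show "(\<integral>\<omega>. (ladder_height \<delta> \<omega> ^ k)\<^sup>2 \<partial>paths) \<le> 1 + c" .
  qed
  show "(\<lambda>n. \<integral>\<omega>. ladder_height (S n) \<omega> ^ k \<partial>paths) \<longlonglongrightarrow> (\<integral>\<omega>. ladder_height 0 \<omega> ^ k \<partial>paths)"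
  proof (rule paths.expectation_tendsto_of_second_moment[where c = "1 + c"])
    show "AE \<omega> in paths. (\<lambda>n. ladder_height (S n) \<omega> ^ k) \<longlonglongrightarrow> ladder_height 0 \<omega> ^ k"
      using AE_ladder_height_tendsto
    proof eventually_elim
      case (elim \<omega>)
      have "filterlim S (at_right 0) sequentially"
        using S(3) S(1) by (simp add: filterlim_at less_imp_neq[symmetric])
      then show ?case
        using elim by (intro tendsto_power) (auto intro: filterlim_compose)
    qed
  qed (use S int bound in \<open>auto simp: less_imp_le\<close>)
qed simp

lemma expected_ladder_height_pos: "0 < (\<integral>\<omega>. ladder_height 0 \<omega> \<partial>paths)"
proof -
  have pos: "AE \<omega> in paths. 0 < ladder_height 0 \<omega>"
    using AE_ladder_height_tendsto by eventually_elim simp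
  have int: "integrable paths (ladder_height 0)"
    by (rule integrable_ladder_height) auto
  have "(\<integral>\<omega>. ladder_height 0 \<omega> \<partial>paths) \<noteq> 0"
  proof
    assume "(\<integral>\<omega>. ladder_height 0 \<omega> \<partial>paths) = 0"
    then have "AE \<omega> in paths. ladder_height 0 \<omega> = 0"
      using pos by (subst (asm) integral_nonneg_eq_0_iff_AE[OF int]) (auto elim: eventually_mono)
    with pos have "AE \<omega> in paths. False" by eventually_elim simp
    then show False by (simp add: paths.AE_False)
  qed
  moreover have "0 \<le> (\<integral>\<omega>. ladder_height 0 \<omega> \<partial>paths)"
    using pos by (intro integral_nonneg_AE) (auto elim: eventually_mono)
  ultimately show ?thesis by simp
qed

text \<open>The constant \<open>\<rho>\<close>, expressed through the driftless walk. It is also the mean of the stationary overshoot in renewal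
  theory.\<close>

definition limiting_overshoot :: real where
  "limiting_overshoot = (\<integral>\<omega>. (ladder_height 0 \<omega>)\<^sup>2 \<partial>paths) / (2 * (\<integral>\<omega>. ladder_height 0 \<omega> \<partial>paths))"

section \<open>The tail of the maximum as a harmonic function\<close>

definition walk_sup :: "real \<Rightarrow> (nat \<Rightarrow> real) \<Rightarrow> ereal" where
  "walk_sup \<delta> \<omega> = (SUP n. ereal (position \<delta> \<omega> n))"

definition sup_tail :: "real \<Rightarrow> real \<Rightarrow> real" where
  "sup_tail \<delta> y = measure paths {\<omega>. ereal y \<le> walk_sup \<delta> \<omega>}"

lemma le_walk_sup_iff: "ereal y \<le> walk_sup \<delta> \<omega> \<longleftrightarrow> (\<forall>e>0. \<exists>n. y - e < position \<delta> \<omega> n)"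
proof
  assume "ereal y \<le> walk_sup \<delta> \<omega>"
  then have *: "\<And>z. z < ereal y \<Longrightarrow> \<exists>n. z < ereal (position \<delta> \<omega> n)"
    by (simp add: walk_sup_def le_SUP_iff)
  show "\<forall>e>0. \<exists>n. y - e < position \<delta> \<omega> n"
  proof (intro allI impI)
    fix e :: real assume "e > 0"
    then show "\<exists>n. y - e < position \<delta> \<omega> n" using *[of "ereal (y - e)"] by simp
  qed
next
  assume *: "\<forall>e>0. \<exists>n. y - e < position \<delta> \<omega> n"
  have "\<exists>n. z < ereal (position \<delta> \<omega> n)" if "z < ereal y" for z
  proof (cases z)
    case (real r)
    with that have "y - r > 0" by simp
    with * obtain n where "y - (y - r) < position \<delta> \<omega> n" by blast
    then show ?thesis using real by auto
  qed (use that in auto)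
  then show "ereal y \<le> walk_sup \<delta> \<omega>"
    by (simp add: walk_sup_def le_SUP_iff)
qed

lemma measurable_walk_sup [measurable]: "walk_sup \<delta> \<in> borel_measurable paths"
  unfolding walk_sup_def by measurable

lemma sets_le_walk_sup [measurable]: "{\<omega>. ereal y \<le> walk_sup \<delta> \<omega>} \<in> sets paths"
  by (rule sets_paths_Collect) measurable

lemma sup_tail_nonpos: "y \<le> 0 \<Longrightarrow> sup_tail \<delta> y = 1"
proof -
  assume "y \<le> 0"
  then have "ereal y \<le> walk_sup \<delta> \<omega>" for \<omega>
    unfolding walk_sup_def by (intro SUP_upper2[of 0]) auto
  then show ?thesis
    using paths.prob_space by (simp add: sup_tail_def)
qed

lemma measurable_sup_tail [measurable]: "sup_tail \<delta> \<in> borel_measurable borel"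
proof -
  have "mono (\<lambda>y. - sup_tail \<delta> y)"
    unfolding sup_tail_def
    by (auto intro!: monoI paths.finite_measure_mono sets_le_walk_sup) (metis ereal_less_eq(3) order_trans)
  then have "(\<lambda>y. - (- sup_tail \<delta> y)) \<in> borel_measurable borel"
    by (intro borel_measurable_uminus borel_measurable_mono)
  then show ?thesis by simp
qed

text \<open>For a positive level the starting point 0 of the walk does not matter, so the maximum can be compared after the
  first step.\<close>

lemma le_walk_sup_first_step:
  assumes "y > 0"
  shows "ereal y \<le> walk_sup \<delta> (case_nat s \<omega>) \<longleftrightarrow> ereal (y - s + \<delta> / 2) \<le> walk_sup \<delta> \<omega>"
  unfolding le_walk_sup_iff
proof (intro iffI allI impI)
  fix e :: real
  assume *: "\<forall>e>0. \<exists>n. y - e < position \<delta> (case_nat s \<omega>) n" and e: "e > 0"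
  then obtain n where n: "y - min e y < position \<delta> (case_nat s \<omega>) n"
    using assms by (metis min_less_iff_conj)
  then have "n \<noteq> 0" by (cases n) auto
  then obtain m where "n = Suc m" by (cases n) auto
  with n show "\<exists>n. y - s + \<delta> / 2 - e < position \<delta> \<omega> n"
    by (intro exI[of _ m]) (auto simp: position_first_step min_def split: if_splits)
next
  fix e :: real
  assume *: "\<forall>e>0. \<exists>n. y - s + \<delta> / 2 - e < position \<delta> \<omega> n" and e: "e > 0"
  then obtain n where "y - s + \<delta> / 2 - e < position \<delta> \<omega> n" by blast
  then show "\<exists>n. y - e < position \<delta> (case_nat s \<omega>) n"
    by (intro exI[of _ "Suc n"]) (simp add: position_first_step)
qed

lemma sup_tail_first_step:
  assumes "y > 0"
  shows "sup_tail \<delta> y = (\<integral>s. sup_tail \<delta> (y - s + \<delta> / 2) \<partial>gauss)"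
proof -
  have "ennreal (sup_tail \<delta> y) = (\<integral>\<^sup>+\<omega>. indicator {\<omega>. ereal y \<le> walk_sup \<delta> \<omega>} \<omega> \<partial>paths)"
    by (simp add: sup_tail_def paths.emeasure_eq_measure)
  also have "\<dots> = (\<integral>\<^sup>+s. \<integral>\<^sup>+\<omega>. indicator {\<omega>. ereal y \<le> walk_sup \<delta> \<omega>} (case_nat s \<omega>) \<partial>paths \<partial>gauss)"
    by (rule nn_integral_paths_first_step) measurable
  also have "\<dots> = (\<integral>\<^sup>+s. \<integral>\<^sup>+\<omega>. indicator {\<omega>. ereal (y - s + \<delta> / 2) \<le> walk_sup \<delta> \<omega>} \<omega> \<partial>paths \<partial>gauss)"
    by (intro nn_integral_cong) (simp add: indicator_def le_walk_sup_first_step[OF assms])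
  also have "\<dots> = (\<integral>\<^sup>+s. ennreal (sup_tail \<delta> (y - s + \<delta> / 2)) \<partial>gauss)"
    by (simp add: sup_tail_def paths.emeasure_eq_measure)
  finally have "ennreal (sup_tail \<delta> y) = (\<integral>\<^sup>+s. ennreal (sup_tail \<delta> (y - s + \<delta> / 2)) \<partial>gauss)" .
  moreover have "(\<integral>s. sup_tail \<delta> (y - s + \<delta> / 2) \<partial>gauss) = enn2real (\<integral>\<^sup>+s. ennreal (sup_tail \<delta> (y - s + \<delta> / 2)) \<partial>gauss)"
    by (rule integral_eq_nn_integral) (auto simp: sup_tail_def)
  ultimately show ?thesis
    by (metis enn2real_ennreal measure_nonneg sup_tail_def)
qed

text \<open>Lundberg's inequality over a finite horizon. The drift \<open>-\<delta>/2\<close> is exactly the one for which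
  \<open>exp (\<delta> S\<^sub>n)\<close> has constant expectation.\<close>

lemma finite_max_tail:
  "measure paths {\<omega>. \<exists>n\<le>N. y \<le> position \<delta> \<omega> n} \<le> exp (- \<delta> * y)" if "\<delta> > 0"
proof (induction N arbitrary: y)
  case 0
  show ?case
    using that paths.prob_space by (cases "y \<le> 0") (auto simp: mult_nonneg_nonpos)
next
  case (Suc N)
  have meas: "{\<omega>. \<exists>n\<le>N. y \<le> position \<delta> \<omega> n} \<in> sets paths" for N y
    by (rule sets_paths_Collect) measurable
  show ?case
  proof (cases "y \<le> 0")
    case True
    then have "1 \<le> exp (- \<delta> * y)" using that by (simp add: mult_nonneg_nonpos)
    then show ?thesis using paths.prob_le_1 order_trans by blast
  next
    case False
    have step: "(\<exists>n\<le>Suc N. y \<le> position \<delta> (case_nat s \<omega>) n) \<longleftrightarrow> (\<exists>n\<le>N. y - s + \<delta> / 2 \<le> position \<delta> \<omega> n)" for s \<omega>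
    proof -
      have "(\<exists>n\<le>Suc N. y \<le> position \<delta> (case_nat s \<omega>) n) \<longleftrightarrow> (\<exists>n\<le>N. y \<le> position \<delta> (case_nat s \<omega>) (Suc n))"
        using False by (metis Suc_le_mono not0_implies_Suc position_0)
      then show ?thesis by (simp add: position_first_step algebra_simps)
    qed
    have "ennreal (measure paths {\<omega>. \<exists>n\<le>Suc N. y \<le> position \<delta> \<omega> n})
        = (\<integral>\<^sup>+\<omega>. indicator {\<omega>. \<exists>n\<le>Suc N. y \<le> position \<delta> \<omega> n} \<omega> \<partial>paths)"
      using meas[where N = "Suc N"] by (simp add: paths.emeasure_eq_measure)
    also have "\<dots> = (\<integral>\<^sup>+s. \<integral>\<^sup>+\<omega>. indicator {\<omega>. \<exists>n\<le>Suc N. y \<le> position \<delta> \<omega> n} (case_nat s \<omega>) \<partial>paths \<partial>gauss)"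
      using meas[where N = "Suc N"] by (intro nn_integral_paths_first_step) measurable
    also have "\<dots> = (\<integral>\<^sup>+s. \<integral>\<^sup>+\<omega>. indicator {\<omega>. \<exists>n\<le>N. y - s + \<delta> / 2 \<le> position \<delta> \<omega> n} \<omega> \<partial>paths \<partial>gauss)"
      by (intro nn_integral_cong) (simp add: indicator_def step)
    also have "\<dots> = (\<integral>\<^sup>+s. ennreal (measure paths {\<omega>. \<exists>n\<le>N. y - s + \<delta> / 2 \<le> position \<delta> \<omega> n}) \<partial>gauss)"
      using meas by (simp add: paths.emeasure_eq_measure)
    also have "\<dots> \<le> (\<integral>\<^sup>+s. ennreal (exp (- \<delta> * (y - s + \<delta> / 2))) \<partial>gauss)"
      by (intro nn_integral_mono ennreal_leI Suc.IH)
    also have "\<dots> = (\<integral>\<^sup>+s. ennreal (exp (- \<delta> * y) * exp (\<delta> * s - \<delta>\<^sup>2 / 2)) \<partial>gauss)"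
      by (simp add: exp_add[symmetric] algebra_simps power2_eq_square)
    also have "\<dots> = ennreal (exp (- \<delta> * y))"
      using integrable_gauss_exp[of \<delta>] integral_gauss_exp[of \<delta>]
      by (subst nn_integral_eq_integral) auto
    finally show ?thesis by simp
  qed
qed

lemma sup_tail_le_exp:
  assumes "\<delta> > 0" shows "sup_tail \<delta> y \<le> exp (- \<delta> * y)"
proof (rule tendsto_lowerbound)
  show "((\<lambda>e. exp (- \<delta> * (y - e))) \<longlongrightarrow> exp (- \<delta> * y)) (at_right 0)"
    by (rule tendsto_eq_intros refl | simp)+
  have "sup_tail \<delta> y \<le> exp (- \<delta> * (y - e))" if "e > 0" for e
  proof -
    let ?A = "\<lambda>N. {\<omega>. \<exists>n\<le>N. y - e \<le> position \<delta> \<omega> n}"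
    have meas: "?A N \<in> sets paths" for N
      by (rule sets_paths_Collect) measurable
    have "(\<lambda>N. measure paths (?A N)) \<longlonglongrightarrow> measure paths (\<Union>N. ?A N)"
      using meas by (intro paths.finite_Lim_measure_incseq) (auto simp: incseq_def intro: order_trans)
    then have "measure paths (\<Union>N. ?A N) \<le> exp (- \<delta> * (y - e))"
      by (rule LIMSEQ_le_const2) (use finite_max_tail[OF assms] in auto)
    moreover have "sup_tail \<delta> y \<le> measure paths (\<Union>N. ?A N)"
      unfolding sup_tail_def
    proof (rule paths.finite_measure_mono)
      show "{\<omega>. ereal y \<le> walk_sup \<delta> \<omega>} \<subseteq> (\<Union>N. ?A N)"
        using that by (fastforce simp: le_walk_sup_iff intro: less_imp_le)
      show "(\<Union>N. ?A N) \<in> sets paths" using meas by blast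
    qed
    ultimately show ?thesis by linarith
  qed
  then show "\<forall>\<^sub>F e in at_right 0. sup_tail \<delta> y \<le> exp (- \<delta> * (y - e))"
    by (auto simp: eventually_at_right_less intro: eventually_mono[OF eventually_at_right_less])
qed simp

text \<open>Let \<open>R\<close> be the depth below 0 at which the walk started at \<open>y > 0\<close> first enters \<open>(-\<infinity>, 0]\<close>. The change of drift
  gives \<open>exp (\<delta> y) P (M \<ge> y) = E (exp (-\<delta> R))\<close>, so this is \<open>E ((1 - exp (-\<delta> R)) / \<delta>)\<close>: the mean overshoot up to
  terms that vanish with \<open>\<delta>\<close>. Below 0 the formula continues with \<open>R = -y\<close>, which is the boundary value that the
  harmonic function needs.\<close>

definition deficit :: "real \<Rightarrow> real \<Rightarrow> real" where
  "deficit \<delta> y = (1 - exp (\<delta> * y) * sup_tail \<delta> y) / \<delta>"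

lemma measurable_deficit [measurable]: "deficit \<delta> \<in> borel_measurable borel"
  unfolding deficit_def by measurable

lemma exp_sup_tail_bounds:
  assumes "\<delta> > 0" shows "0 \<le> exp (\<delta> * y) * sup_tail \<delta> y" "exp (\<delta> * y) * sup_tail \<delta> y \<le> 1"
proof -
  show "0 \<le> exp (\<delta> * y) * sup_tail \<delta> y" by (simp add: sup_tail_def)
  have "exp (\<delta> * y) * sup_tail \<delta> y \<le> exp (\<delta> * y) * exp (- \<delta> * y)"
    by (intro mult_left_mono sup_tail_le_exp assms) simp
  then show "exp (\<delta> * y) * sup_tail \<delta> y \<le> 1" by (simp add: exp_minus_inverse)
qed

lemma deficit_nonneg: "\<delta> > 0 \<Longrightarrow> 0 \<le> deficit \<delta> y"
  using exp_sup_tail_bounds[of \<delta> y] by (simp add: deficit_def)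

lemma deficit_le: "\<delta> > 0 \<Longrightarrow> deficit \<delta> y \<le> 1 / \<delta>"
  using exp_sup_tail_bounds[of \<delta> y] by (simp add: deficit_def divide_right_mono)

lemma deficit_nonpos: "y \<le> 0 \<Longrightarrow> deficit \<delta> y = (1 - exp (\<delta> * y)) / \<delta>"
  by (simp add: deficit_def sup_tail_nonpos)

lemma deficit_nonpos_le: "\<delta> > 0 \<Longrightarrow> y \<le> 0 \<Longrightarrow> deficit \<delta> y \<le> - y"
  using exp_ge_add_one_self[of "\<delta> * y"] by (simp add: deficit_nonpos field_simps)

lemma gauss_reflect:
  fixes f :: "real \<Rightarrow> real"
  assumes [measurable]: "f \<in> borel_measurable borel"
  shows "(\<integral>s. f (- s) \<partial>gauss) = (\<integral>s. f s \<partial>gauss)"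
proof -
  have "(\<integral>s. f (- s) \<partial>gauss) = (\<integral>s. std_normal_density s * f (- s) \<partial>lborel)"
    by (rule integral_gauss) measurable
  also have "\<dots> = (\<integral>s. std_normal_density s * f s \<partial>lborel)"
    by (subst lborel_integral_real_affine[where c = "-1" and t = 0]) (simp_all add: std_normal_density_def)
  also have "\<dots> = (\<integral>s. f s \<partial>gauss)"
    by (rule integral_gauss[symmetric]) measurable
  finally show ?thesis .
qed

text \<open>The first-step equation for the tail of the maximum moves the level by the negative of a step with drift
  \<open>-\<delta>/2\<close>, that is, by a step with drift \<open>\<delta>/2\<close>. Multiplying by \<open>exp (\<delta> y)\<close> tilts the step back to drift
  \<open>-\<delta>/2\<close>. So tail and ladder height become statements about the same walk.\<close>

lemma deficit_harmonic:
  assumes "\<delta> > 0" "y > 0"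
  shows "ennreal (deficit \<delta> y) = (\<integral>\<^sup>+s. ennreal (deficit \<delta> (y + s - \<delta> / 2)) \<partial>gauss)"
proof -
  define H where "H v = exp (\<delta> * v) * sup_tail \<delta> v" for v
  have [measurable]: "H \<in> borel_measurable borel"
    unfolding H_def by measurable
  have H: "0 \<le> H v" "H v \<le> 1" for v
    using exp_sup_tail_bounds[OF assms(1)] by (auto simp: H_def)
  have H_int: "integrable gauss (\<lambda>s. H (y + s - \<delta> / 2))"
    by (rule gauss.integrable_const_bound[where B = 1]) (use H in auto)
  have "H y = exp (\<delta> * y) * (\<integral>s. sup_tail \<delta> (y - s + \<delta> / 2) \<partial>gauss)"
    unfolding H_def sup_tail_first_step[OF assms(2)] ..
  also have "(\<integral>s. sup_tail \<delta> (y - s + \<delta> / 2) \<partial>gauss) = (\<integral>s. sup_tail \<delta> (y + s + \<delta> / 2) \<partial>gauss)"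
    by (subst gauss_reflect[symmetric]) simp_all
  also have "exp (\<delta> * y) * \<dots> = (\<integral>s. exp (\<delta> * y) * sup_tail \<delta> (y + s + \<delta> / 2) \<partial>gauss)"
    by simp
  also have "\<dots> = (\<integral>s. exp (- \<delta> * s - (- \<delta>)\<^sup>2 / 2) * H (y + s + \<delta> / 2) \<partial>gauss)"
  proof -
    have "exp (- \<delta> * s - (- \<delta>)\<^sup>2 / 2) * exp (\<delta> * (y + s + \<delta> / 2)) = exp (\<delta> * y)" for s
      by (subst exp_add[symmetric]) (simp add: algebra_simps power2_eq_square)
    then show ?thesis
      by (simp only: H_def mult.assoc[symmetric])
  qed
  also have "\<dots> = (\<integral>s. H (y + (s + - \<delta>) + \<delta> / 2) \<partial>gauss)"
    by (rule gauss_translate[symmetric]) measurable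
  also have "\<dots> = (\<integral>s. H (y + s - \<delta> / 2) \<partial>gauss)"
    by simp
  finally have "H y = (\<integral>s. H (y + s - \<delta> / 2) \<partial>gauss)" .
  then have "deficit \<delta> y = (\<integral>s. deficit \<delta> (y + s - \<delta> / 2) \<partial>gauss)"
    unfolding deficit_def H_def[symmetric] using H_int by (simp add: gauss.prob_space[simplified])
  moreover have "integrable gauss (\<lambda>s. deficit \<delta> (y + s - \<delta> / 2))"
    unfolding deficit_def H_def[symmetric] using H_int by simp
  ultimately show ?thesis
    using deficit_nonneg[OF assms(1)] by (subst nn_integral_eq_integral) auto
qed

text \<open>The renewal equation of the ladder process. Here the level \<open>y\<close> of the walk is moved to 0, so that the walk stops
  at its first ladder point whatever \<open>y > 0\<close> is.\<close>

lemma deficit_renewal: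
  assumes "\<delta> > 0" "y > 0"
  shows "ennreal (deficit \<delta> y) = (\<integral>\<^sup>+\<omega>. ennreal (deficit \<delta> (y - ladder_height \<delta> \<omega>)) \<partial>paths)"
proof -
  have "(\<lambda>z. ennreal (deficit \<delta> (y + z))) 0 = (\<integral>\<^sup>+\<omega>. (\<lambda>z. ennreal (deficit \<delta> (y + z))) (- ladder_height \<delta> \<omega>) \<partial>paths)"
  proof (rule harmonic_ladder)
    show "ennreal (deficit \<delta> (y + z)) = (\<integral>\<^sup>+s. ennreal (deficit \<delta> (y + (z + s - \<delta> / 2))) \<partial>gauss)" if "z \<ge> 0" for z
      using deficit_harmonic[of \<delta> "y + z"] assms that by (simp add: add.assoc add_diff_eq)
    show "ennreal (deficit \<delta> (y + z)) \<le> ennreal (1 / \<delta>)" for z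
      by (intro ennreal_leI deficit_le assms)
  qed (use assms in auto)
  then show ?thesis by simp
qed

section \<open>Local flatness of the deficit\<close>

lemma sets_alive [measurable]: "{\<omega>. alive \<delta> n z \<omega>} \<in> sets paths"
  by (rule sets_paths_Collect) measurable

lemma sets_not_alive [measurable]: "{\<omega>. \<not> alive \<delta> n z \<omega>} \<in> sets paths"
  by (rule sets_paths_Collect) measurable

lemma expected_not_alive:
  "(\<integral>\<^sup>+\<omega>. (if alive \<delta> n z \<omega> then 0 else 1) \<partial>paths) = ennreal (measure paths {\<omega>. \<not> alive \<delta> n z \<omega>})"
proof -
  have "(\<integral>\<^sup>+\<omega>. (if alive \<delta> n z \<omega> then 0 else 1) \<partial>paths) = (\<integral>\<^sup>+\<omega>. indicator {\<omega>. \<not> alive \<delta> n z \<omega>} \<omega> \<partial>paths)"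
    by (intro nn_integral_cong) (simp add: indicator_def)
  then show ?thesis by (simp add: paths.emeasure_eq_measure)
qed

lemma deficit_decomposition:
  assumes "\<delta> > 0" "y > 0"
  shows "ennreal (deficit \<delta> y) = (\<integral>\<^sup>+\<omega>. stopped \<delta> n (\<lambda>u. ennreal (deficit \<delta> u)) y \<omega> \<partial>paths)
    + (\<integral>\<^sup>+\<omega>. (if alive \<delta> n y \<omega> then ennreal (deficit \<delta> (y + position \<delta> \<omega> n)) else 0) \<partial>paths)"
  by (rule optional_stopping) (auto intro: deficit_harmonic assms)

text \<open>Stopping turns the deficit into an average of its boundary values, which are at most the overshoot, and the
  overshoot has bounded moments. The second part says how much of that average is collected by a given
  time.\<close>

lemma deficit_bounds:
  "\<exists>c\<ge>1. \<forall>\<delta>. 0 < \<delta> \<longrightarrow> \<delta> \<le> 1 \<longrightarrow> (\<forall>y. 0 < y \<longrightarrow> deficit \<delta> y \<le> c) \<and>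
    (\<forall>n y. 0 < y \<longrightarrow> (\<integral>\<^sup>+\<omega>. stopped \<delta> n (\<lambda>u. ennreal (deficit \<delta> u)) y \<omega> \<partial>paths)
        \<le> ennreal (c * measure paths {\<omega>. \<not> alive \<delta> n y \<omega>}))"
proof -
  obtain c :: real where c: "c \<ge> 1" and bound: "\<And>\<delta> z n. 0 \<le> \<delta> \<Longrightarrow> \<delta> \<le> 1 \<Longrightarrow> 0 \<le> z \<Longrightarrow>
    (\<integral>\<^sup>+\<omega>. stopped \<delta> n (\<lambda>u. ennreal (1 + u ^ 4)) z \<omega> \<partial>paths)
      \<le> ennreal c * (\<integral>\<^sup>+\<omega>. (if alive \<delta> n z \<omega> then 0 else 1) \<partial>paths)"
    using overshoot_constant by blast
  show ?thesis
  proof (intro exI[of _ c] conjI c allI impI)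
    fix \<delta> :: real assume \<delta>: "0 < \<delta>" "\<delta> \<le> 1"
    have le: "deficit \<delta> u \<le> 1 + u ^ 4" if "u \<le> 0" for u
      using deficit_nonpos_le[OF \<delta>(1) that] abs_power_le_one_plus_quartic[of 1 u] by simp
    show stop: "(\<integral>\<^sup>+\<omega>. stopped \<delta> n (\<lambda>u. ennreal (deficit \<delta> u)) y \<omega> \<partial>paths)
        \<le> ennreal (c * measure paths {\<omega>. \<not> alive \<delta> n y \<omega>})" if "0 < y" for n y
    proof -
      have "(\<integral>\<^sup>+\<omega>. stopped \<delta> n (\<lambda>u. ennreal (deficit \<delta> u)) y \<omega> \<partial>paths)
          \<le> (\<integral>\<^sup>+\<omega>. stopped \<delta> n (\<lambda>u. ennreal (1 + u ^ 4)) y \<omega> \<partial>paths)"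
        by (intro nn_integral_mono stopped_mono ennreal_leI le)
      also have "\<dots> \<le> ennreal c * ennreal (measure paths {\<omega>. \<not> alive \<delta> n y \<omega>})"
        using bound[of \<delta> y n] \<delta> that by (simp add: expected_not_alive)
      finally show ?thesis using c by (simp add: ennreal_mult)
    qed
    show "deficit \<delta> y \<le> c" if y: "0 < y" for y
    proof (rule LIMSEQ_le_const)
      show "(\<lambda>n. c + 1 / \<delta> * measure paths {\<omega>. alive 0 n y \<omega>}) \<longlonglongrightarrow> c"
        using tendsto_add[OF tendsto_const tendsto_mult_right[OF alive_probability_tendsto_0[of y], of "1 / \<delta>"], of c] by simp
      have "deficit \<delta> y \<le> c + 1 / \<delta> * measure paths {\<omega>. alive 0 n y \<omega>}" for n
      proof -
        have "(\<integral>\<^sup>+\<omega>. (if alive \<delta> n y \<omega> then ennreal (deficit \<delta> (y + position \<delta> \<omega> n)) else 0) \<partial>paths)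
            \<le> (\<integral>\<^sup>+\<omega>. ennreal (1 / \<delta>) * indicator {\<omega>. alive 0 n y \<omega>} \<omega> \<partial>paths)"
          using \<delta> alive_anti_drift[of \<delta> n y] deficit_le[of \<delta>]
          by (intro nn_integral_mono) (auto simp: indicator_def intro!: ennreal_leI)
        also have "\<dots> = ennreal (1 / \<delta> * measure paths {\<omega>. alive 0 n y \<omega>})"
          using \<delta> by (simp add: nn_integral_cmult paths.emeasure_eq_measure ennreal_mult[symmetric])
        finally have "ennreal (deficit \<delta> y) \<le> ennreal (c * measure paths {\<omega>. \<not> alive \<delta> n y \<omega>})
            + ennreal (1 / \<delta> * measure paths {\<omega>. alive 0 n y \<omega>})"
          unfolding deficit_decomposition[OF \<delta>(1) y, of n] by (intro add_mono stop y)
        also have "\<dots> \<le> ennreal c + ennreal (1 / \<delta> * measure paths {\<omega>. alive 0 n y \<omega>})"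
          using c by (intro add_right_mono ennreal_leI) (simp add: mult_left_le)
        also have "\<dots> = ennreal (c + 1 / \<delta> * measure paths {\<omega>. alive 0 n y \<omega>})"
          using c \<delta> by (intro ennreal_plus[symmetric]) auto
        finally show ?thesis
          using c \<delta> by (subst (asm) ennreal_le_iff) (auto intro!: add_nonneg_nonneg)
      qed
      then show "\<exists>N. \<forall>n\<ge>N. deficit \<delta> y \<le> c + 1 / \<delta> * measure paths {\<omega>. alive 0 n y \<omega>}" by blast
    qed
  qed
qed

text \<open>From a great height the walk survives any fixed number of steps with high probability. The drift in
  \<open>[0, 1]\<close> moves \<open>n\<close> steps by at most \<open>n/2\<close>, so that a comparison with the driftless walk gives uniformity.\<close>

lemma early_death_small:
  assumes "\<epsilon> > 0"
  obtains Y where "Y > 0"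
    "\<And>y \<delta>. Y \<le> y \<Longrightarrow> 0 \<le> \<delta> \<Longrightarrow> \<delta> \<le> 1 \<Longrightarrow> measure paths {\<omega>. \<not> alive \<delta> n y \<omega>} \<le> \<epsilon>"
proof -
  let ?B = "\<lambda>m. {\<omega>. \<not> alive 0 n (real m) \<omega>}"
  have "(\<lambda>m. measure paths (?B m)) \<longlonglongrightarrow> measure paths (\<Inter>m. ?B m)"
  proof (rule paths.finite_Lim_measure_decseq)
    show "decseq ?B"
      unfolding decseq_def alive_def by (force intro: less_le_trans)
  qed auto
  moreover have "(\<Inter>m. ?B m) = {}"
  proof -
    have "\<exists>m. alive 0 n (real m) \<omega>" for \<omega>
    proof -
      obtain m :: nat where m: "(\<Sum>k<n. \<bar>position 0 \<omega> (Suc k)\<bar>) < real m"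
        using reals_Archimedean2 by blast
      have "real m + position 0 \<omega> (Suc k) > 0" if "k < n" for k
        using m member_le_sum[of k "{..<n}" "\<lambda>k. \<bar>position 0 \<omega> (Suc k)\<bar>"] that by auto
      then show ?thesis by (auto simp: alive_def)
    qed
    then show ?thesis by auto
  qed
  ultimately have "(\<lambda>m. measure paths (?B m)) \<longlonglongrightarrow> 0" by simp
  from order_tendstoD(2)[OF this assms] obtain M where M: "measure paths (?B M) < \<epsilon>"
    by (auto simp: eventually_sequentially)
  show thesis
  proof (rule that[of "real M + real n / 2 + 1"])
    fix y \<delta> :: real assume *: "real M + real n / 2 + 1 \<le> y" "0 \<le> \<delta>" "\<delta> \<le> 1"
    have "alive \<delta> n y \<omega>" if "alive 0 n (real M) \<omega>" for \<omega>
      unfolding alive_def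
    proof (intro allI impI)
      fix k assume k: "k < n"
      have "real M + position 0 \<omega> (Suc k) > 0" using that k by (auto simp: alive_def)
      moreover have "real (Suc k) * \<delta> \<le> real n * 1"
        using k * by (intro mult_mono) auto
      ultimately show "y + position \<delta> \<omega> (Suc k) > 0"
        using * by (subst position_drift) linarith
    qed
    then have "measure paths {\<omega>. \<not> alive \<delta> n y \<omega>} \<le> measure paths (?B M)"
      by (intro paths.finite_measure_mono) auto
    then show "measure paths {\<omega>. \<not> alive \<delta> n y \<omega>} \<le> \<epsilon>" using M by linarith
  qed (simp add: add_nonneg_pos)
qed

text \<open>Extend the deficit by 0 to the negative half-line. It then differs from its average over the unrestricted
  \<open>n\<close>-step walk only on the paths that died early, and both error terms are bounded by \<open>c\<close> times their
  probability.\<close>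

lemma deficit_smoothed:
  assumes \<delta>: "\<delta> > 0" and y: "y > 0" and c: "c \<ge> 0"
    and bound: "\<And>u. 0 < u \<Longrightarrow> deficit \<delta> u \<le> c"
    and stop: "(\<integral>\<^sup>+\<omega>. stopped \<delta> n (\<lambda>u. ennreal (deficit \<delta> u)) y \<omega> \<partial>paths)
        \<le> ennreal (c * measure paths {\<omega>. \<not> alive \<delta> n y \<omega>})"
  shows "\<bar>deficit \<delta> y - (\<integral>\<omega>. (if y + position \<delta> \<omega> n > 0 then deficit \<delta> (y + position \<delta> \<omega> n) else 0) \<partial>paths)\<bar>
    \<le> c * measure paths {\<omega>. \<not> alive \<delta> n y \<omega>}"
proof -
  let ?D = "\<lambda>\<omega>. if y + position \<delta> \<omega> n > 0 then deficit \<delta> (y + position \<delta> \<omega> n) else 0"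
  define q where "q = c * measure paths {\<omega>. \<not> alive \<delta> n y \<omega>}"
  define X where "X = (\<integral>\<omega>. ?D \<omega> \<partial>paths)"
  define V where "V = (\<integral>\<^sup>+\<omega>. stopped \<delta> n (\<lambda>u. ennreal (deficit \<delta> u)) y \<omega> \<partial>paths)"
  define A where "A = (\<integral>\<^sup>+\<omega>. (if alive \<delta> n y \<omega> then ennreal (deficit \<delta> (y + position \<delta> \<omega> n)) else 0) \<partial>paths)"
  define B where "B = (\<integral>\<^sup>+\<omega>. (if alive \<delta> n y \<omega> then 0 else ennreal (?D \<omega>)) \<partial>paths)"
  have D: "0 \<le> ?D \<omega>" "?D \<omega> \<le> c" for \<omega>
    using deficit_nonneg[OF \<delta>] bound c by auto
  have alive_pos: "y + position \<delta> \<omega> n > 0" if "alive \<delta> n y \<omega>" for \<omega>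
  proof (cases n)
    case (Suc m)
    with that show ?thesis unfolding alive_def by blast
  qed (use y in simp)
  have "integrable paths ?D"
    by (rule paths.integrable_const_bound[where B = c]) (use D in auto)
  then have "ennreal X = (\<integral>\<^sup>+\<omega>. ennreal (?D \<omega>) \<partial>paths)"
    unfolding X_def using D by (intro nn_integral_eq_integral[symmetric]) auto
  also have "\<dots> = (\<integral>\<^sup>+\<omega>. (if alive \<delta> n y \<omega> then ennreal (deficit \<delta> (y + position \<delta> \<omega> n)) else 0)
      + (if alive \<delta> n y \<omega> then 0 else ennreal (?D \<omega>)) \<partial>paths)"
    using alive_pos by (intro nn_integral_cong) auto
  also have "\<dots> = A + B"
    unfolding A_def B_def by (rule nn_integral_add) measurable
  finally have X: "ennreal X = A + B" .
  have "B \<le> (\<integral>\<^sup>+\<omega>. ennreal c * (if alive \<delta> n y \<omega> then 0 else 1) \<partial>paths)"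
    unfolding B_def using c by (intro nn_integral_mono) (auto intro!: ennreal_leI bound)
  also have "\<dots> = ennreal c * (\<integral>\<^sup>+\<omega>. (if alive \<delta> n y \<omega> then 0 else 1) \<partial>paths)"
    by (rule nn_integral_cmult) measurable
  also have "\<dots> = ennreal q"
    using c by (simp add: expected_not_alive q_def ennreal_mult)
  finally have B: "B \<le> ennreal q" .
  have V: "V \<le> ennreal q" using stop by (simp add: V_def q_def)
  have d: "ennreal (deficit \<delta> y) = V + A"
    unfolding V_def A_def by (rule deficit_decomposition[OF \<delta> y])
  have q: "q \<ge> 0" using c by (simp add: q_def)
  have X0: "X \<ge> 0" unfolding X_def using D by (intro integral_nonneg_AE) auto
  have "ennreal (deficit \<delta> y) \<le> ennreal q + ennreal X"
    unfolding d X by (intro add_mono V) (simp add: add_increasing2)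
  moreover have "ennreal X \<le> ennreal q + ennreal (deficit \<delta> y)"
    unfolding d X by (subst add.commute) (intro add_mono B; simp add: add_increasing)
  ultimately have "deficit \<delta> y \<le> q + X" "X \<le> q + deficit \<delta> y"
    using q X0 deficit_nonneg[OF \<delta>, of y] by (simp_all add: ennreal_plus[symmetric] del: ennreal_plus)
  then show ?thesis
    unfolding X_def[symmetric] q_def[symmetric] by linarith
qed

text \<open>Far from the boundary, uniformly in the drift: the deficit is close to its average over \<open>n\<close> steps by
  \<open>deficit_smoothed\<close>, and that average depends little on the starting height by
  \<open>position_translate_bound\<close>. First \<open>n\<close> is chosen for the second error, then the height for the first.\<close>

lemma deficit_locally_flat:
  assumes \<epsilon>: "\<epsilon> > 0" and L: "L > 0"
  obtains Y where "Y > 0"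
    "\<And>\<delta> x y. 0 < \<delta> \<Longrightarrow> \<delta> \<le> 1 \<Longrightarrow> Y \<le> x \<Longrightarrow> Y \<le> y \<Longrightarrow> \<bar>x - y\<bar> \<le> L \<Longrightarrow> \<bar>deficit \<delta> x - deficit \<delta> y\<bar> \<le> \<epsilon>"
proof -
  obtain c where c: "c \<ge> 1" and bound: "\<And>\<delta> y. 0 < \<delta> \<Longrightarrow> \<delta> \<le> 1 \<Longrightarrow> 0 < y \<Longrightarrow> deficit \<delta> y \<le> c"
    and stop: "\<And>\<delta> n y. 0 < \<delta> \<Longrightarrow> \<delta> \<le> 1 \<Longrightarrow> 0 < y \<Longrightarrow>
      (\<integral>\<^sup>+\<omega>. stopped \<delta> n (\<lambda>u. ennreal (deficit \<delta> u)) y \<omega> \<partial>paths)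
        \<le> ennreal (c * measure paths {\<omega>. \<not> alive \<delta> n y \<omega>})"
    using deficit_bounds by blast
  have "(\<lambda>n. c * sqrt (exp (L\<^sup>2 / real n) - 1)) \<longlonglongrightarrow> c * sqrt (exp 0 - 1)"
    by (intro tendsto_intros lim_const_over_n)
  then have "\<forall>\<^sub>F n in sequentially. c * sqrt (exp (L\<^sup>2 / real n) - 1) < \<epsilon> / 2"
    using \<epsilon> by (intro order_tendstoD) auto
  moreover have "\<forall>\<^sub>F n in sequentially. (n::nat) > 0" by (rule eventually_gt_at_top)
  ultimately have "\<forall>\<^sub>F n in sequentially. n > 0 \<and> c * sqrt (exp (L\<^sup>2 / real n) - 1) < \<epsilon> / 2"
    by eventually_elim simp
  then obtain n :: nat where n: "n > 0" "c * sqrt (exp (L\<^sup>2 / real n) - 1) < \<epsilon> / 2"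
    by (auto simp: eventually_sequentially)
  obtain Y where Y: "Y > 0" and early:
    "\<And>y \<delta>. Y \<le> y \<Longrightarrow> 0 \<le> \<delta> \<Longrightarrow> \<delta> \<le> 1 \<Longrightarrow> measure paths {\<omega>. \<not> alive \<delta> n y \<omega>} \<le> \<epsilon> / (4 * c)"
    using early_death_small[of "\<epsilon> / (4 * c)" n] \<epsilon> c by auto
  show thesis
  proof (rule that[OF Y])
    fix \<delta> x y :: real
    assume \<delta>: "0 < \<delta>" "\<delta> \<le> 1" and xy: "Y \<le> x" "Y \<le> y" "\<bar>x - y\<bar> \<le> L"
    define D where "D u = (if u > 0 then deficit \<delta> u else 0)" for u
    have [measurable]: "D \<in> borel_measurable borel"
      unfolding D_def by measurable
    have smooth: "\<bar>deficit \<delta> z - (\<integral>\<omega>. D (z + position \<delta> \<omega> n) \<partial>paths)\<bar> \<le> \<epsilon> / 4" if "Y \<le> z" for z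
    proof -
      have z: "z > 0" using that Y by linarith
      have "\<bar>deficit \<delta> z - (\<integral>\<omega>. D (z + position \<delta> \<omega> n) \<partial>paths)\<bar> \<le> c * measure paths {\<omega>. \<not> alive \<delta> n z \<omega>}"
        unfolding D_def using c by (intro deficit_smoothed \<delta> z bound stop) auto
      also have "\<dots> \<le> c * (\<epsilon> / (4 * c))"
        using c \<delta> that by (intro mult_left_mono early) auto
      finally show ?thesis using c by simp
    qed
    have "\<bar>(\<integral>\<omega>. D (x + position \<delta> \<omega> n) \<partial>paths) - (\<integral>\<omega>. D (y + position \<delta> \<omega> n) \<partial>paths)\<bar>
        \<le> c * sqrt (exp ((x - y)\<^sup>2 / real n) - 1)"
      using n(1) c bound[OF \<delta>] deficit_nonneg[OF \<delta>(1)]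
      by (intro position_translate_bound) (auto simp: D_def)
    also have "\<dots> \<le> c * sqrt (exp (L\<^sup>2 / real n) - 1)"
    proof -
      have "(x - y)\<^sup>2 \<le> L\<^sup>2" using xy(3) L by (intro abs_le_square_iff[THEN iffD1]) simp
      then show ?thesis using c by (simp add: divide_right_mono)
    qed
    finally show "\<bar>deficit \<delta> x - deficit \<delta> y\<bar> \<le> \<epsilon>"
      using smooth[OF xy(1)] smooth[OF xy(2)] n(2) by linarith
  qed
qed

section \<open>The integrated renewal equation\<close>

definition deficit_integral :: "real \<Rightarrow> real \<Rightarrow> real \<Rightarrow> ennreal" where
  "deficit_integral \<delta> a b = (\<integral>\<^sup>+u. (if a < u \<and> u \<le> b then ennreal (deficit \<delta> u) else 0) \<partial>lborel)"

lemma deficit_integral_split: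
  assumes "a \<le> b" "b \<le> c"
  shows "deficit_integral \<delta> a b + deficit_integral \<delta> b c = deficit_integral \<delta> a c"
  unfolding deficit_integral_def
  using assms by (subst nn_integral_add[symmetric]) (auto intro!: nn_integral_cong)

lemma deficit_integral_le:
  assumes "\<And>u. a < u \<Longrightarrow> u \<le> b \<Longrightarrow> deficit \<delta> u \<le> M" "a \<le> b" "0 \<le> M"
  shows "deficit_integral \<delta> a b \<le> ennreal (M * (b - a))"
proof -
  have "deficit_integral \<delta> a b \<le> (\<integral>\<^sup>+u. ennreal M * indicator {a<..b} u \<partial>lborel)"
    unfolding deficit_integral_def using assms
    by (intro nn_integral_mono) (auto simp: indicator_def intro!: ennreal_leI)
  also have "\<dots> = ennreal (M * (b - a))"
    using assms by (simp add: nn_integral_cmult ennreal_mult)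
  finally show ?thesis .
qed

lemma deficit_integral_ge:
  assumes "\<And>u. a < u \<Longrightarrow> u \<le> b \<Longrightarrow> M \<le> deficit \<delta> u" "a \<le> b"
  shows "ennreal (M * (b - a)) \<le> deficit_integral \<delta> a b"
proof (cases "0 \<le> M")
  case True
  then have "ennreal (M * (b - a)) = (\<integral>\<^sup>+u. ennreal M * indicator {a<..b} u \<partial>lborel)"
    using assms by (simp add: nn_integral_cmult ennreal_mult)
  also have "\<dots> \<le> deficit_integral \<delta> a b"
    unfolding deficit_integral_def using assms
    by (intro nn_integral_mono) (auto simp: indicator_def intro!: ennreal_leI)
  finally show ?thesis .
next
  case False
  then have "M * (b - a) \<le> 0" using assms by (intro mult_nonpos_nonneg) auto
  then show ?thesis by (simp add: ennreal_neg)
qed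

lemma measurable_deficit_integral [measurable]:
  assumes [measurable]: "f \<in> borel_measurable M" "g \<in> borel_measurable M"
  shows "(\<lambda>x. deficit_integral \<delta> (f x) (g x)) \<in> borel_measurable M"
  unfolding deficit_integral_def by measurable

lemma deficit_integral_translate:
  "(\<integral>\<^sup>+u. (if a < u \<and> u \<le> b then ennreal (deficit \<delta> (u - h)) else 0) \<partial>lborel) = deficit_integral \<delta> (a - h) (b - h)"
  unfolding deficit_integral_def
  by (subst nn_integral_real_affine[where c = 1 and t = h])
     (auto intro!: nn_integral_cong simp: algebra_simps)

interpretation paths_lborel: pair_sigma_finite paths "lborel :: real measure"
  by unfold_locales

text \<open>Integrate the renewal equation over \<open>(0, Y]\<close>. On the right the window is shifted down by the ladder height,
  and the overlap of the two windows cancels. What is left compares the deficit just below \<open>Y\<close> with the explicit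
  boundary values just below 0. This is how the ladder moments enter, without a renewal theorem.\<close>

lemma integrated_renewal:
  assumes \<delta>: "\<delta> > 0" and Y: "Y > 0"
  shows "(\<integral>\<^sup>+\<omega>. deficit_integral \<delta> (Y - ladder_height \<delta> \<omega>) Y \<partial>paths)
       = (\<integral>\<^sup>+\<omega>. deficit_integral \<delta> (- ladder_height \<delta> \<omega>) 0 \<partial>paths)"
proof -
  let ?h = "ladder_height \<delta>" and ?I = "deficit_integral \<delta>"
  have "?I 0 Y = (\<integral>\<^sup>+u. (if 0 < u \<and> u \<le> Y then (\<integral>\<^sup>+\<omega>. ennreal (deficit \<delta> (u - ?h \<omega>)) \<partial>paths) else 0) \<partial>lborel)"
    unfolding deficit_integral_def
    by (intro nn_integral_cong) (simp add: deficit_renewal[OF \<delta>])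
  also have "\<dots> = (\<integral>\<^sup>+u. (\<integral>\<^sup>+\<omega>. (if 0 < u \<and> u \<le> Y then ennreal (deficit \<delta> (u - ?h \<omega>)) else 0) \<partial>paths) \<partial>lborel)"
  proof (rule nn_integral_cong)
    fix u :: real
    show "(if 0 < u \<and> u \<le> Y then (\<integral>\<^sup>+\<omega>. ennreal (deficit \<delta> (u - ?h \<omega>)) \<partial>paths) else 0)
        = (\<integral>\<^sup>+\<omega>. (if 0 < u \<and> u \<le> Y then ennreal (deficit \<delta> (u - ?h \<omega>)) else 0) \<partial>paths)"
      by (cases "0 < u"; cases "u \<le> Y") simp_all
  qed
  also have "\<dots> = (\<integral>\<^sup>+\<omega>. (\<integral>\<^sup>+u. (if 0 < u \<and> u \<le> Y then ennreal (deficit \<delta> (u - ?h \<omega>)) else 0) \<partial>lborel) \<partial>paths)"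
    by (rule paths_lborel.Fubini') measurable
  also have "\<dots> = (\<integral>\<^sup>+\<omega>. ?I (- ?h \<omega>) (Y - ?h \<omega>) \<partial>paths)"
    by (simp add: deficit_integral_translate)
  finally have shift: "?I 0 Y = (\<integral>\<^sup>+\<omega>. ?I (- ?h \<omega>) (Y - ?h \<omega>) \<partial>paths)" .
  have "?I 0 Y + (\<integral>\<^sup>+\<omega>. ?I (Y - ?h \<omega>) Y \<partial>paths) = (\<integral>\<^sup>+\<omega>. ?I (- ?h \<omega>) (Y - ?h \<omega>) + ?I (Y - ?h \<omega>) Y \<partial>paths)"
    unfolding shift by (rule nn_integral_add[symmetric]) measurable
  also have "\<dots> = (\<integral>\<^sup>+\<omega>. ?I 0 Y + ?I (- ?h \<omega>) 0 \<partial>paths)"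
  proof (rule nn_integral_cong_AE)
    show "AE \<omega> in paths. ?I (- ?h \<omega>) (Y - ?h \<omega>) + ?I (Y - ?h \<omega>) Y = ?I 0 Y + ?I (- ?h \<omega>) 0"
      using ladder_height_nonneg[OF less_imp_le[OF \<delta>]]
    proof eventually_elim
      case (elim \<omega>)
      have "?I (- ?h \<omega>) (Y - ?h \<omega>) + ?I (Y - ?h \<omega>) Y = ?I (- ?h \<omega>) Y"
        using elim Y by (intro deficit_integral_split) auto
      also have "\<dots> = ?I (- ?h \<omega>) 0 + ?I 0 Y"
        using elim Y by (intro deficit_integral_split[symmetric]) auto
      finally show ?case by (simp add: add.commute)
    qed
  qed
  also have "\<dots> = (\<integral>\<^sup>+\<omega>. ?I 0 Y \<partial>paths) + (\<integral>\<^sup>+\<omega>. ?I (- ?h \<omega>) 0 \<partial>paths)"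
    by (rule nn_integral_add) measurable
  also have "(\<integral>\<^sup>+\<omega>. ?I 0 Y \<partial>paths) = ?I 0 Y"
    by (simp add: paths.emeasure_space_1[simplified])
  finally have eq: "?I 0 Y + (\<integral>\<^sup>+\<omega>. ?I (Y - ?h \<omega>) Y \<partial>paths) = ?I 0 Y + (\<integral>\<^sup>+\<omega>. ?I (- ?h \<omega>) 0 \<partial>paths)" .
  have "?I 0 Y \<le> ennreal (1 / \<delta> * (Y - 0))"
    using \<delta> Y deficit_le[OF \<delta>] by (intro deficit_integral_le) auto
  \<comment> \<open>finiteness is what allows the cancellation of \<open>?I 0 Y\<close>\<close>
  then have "?I 0 Y \<noteq> \<infinity>"
    by (simp add: neq_top_trans[OF ennreal_neq_top])
  with eq show ?thesis
    by (simp add: ennreal_add_left_cancel)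
qed

text \<open>Taylor estimates for the exponential that hold on the whole negative half-line, each from the derivative
  of the difference.\<close>

lemma exp_nonpos_bounds:
  fixes v :: real
  assumes "v \<le> 0"
  shows "exp v \<le> 1 + v + v\<^sup>2 / 2" and "1 + v + v\<^sup>2 / 2 + v ^ 3 / 6 \<le> exp v"
proof -
  have le: "exp u \<le> 1 + u + u\<^sup>2 / 2" if "u \<le> 0" for u :: real
  proof -
    have "(\<lambda>u. 1 + u + u\<^sup>2 / 2 - exp u) u \<ge> (\<lambda>u. 1 + u + u\<^sup>2 / 2 - exp u) 0"
    proof (rule DERIV_nonpos_imp_nonincreasing[OF that])
      fix x :: real
      have "((\<lambda>u. 1 + u + u\<^sup>2 / 2 - exp u) has_real_derivative 1 + x - exp x) (at x)"
        by (auto intro!: derivative_eq_intros)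
      moreover have "1 + x - exp x \<le> 0" using exp_ge_add_one_self[of x] by linarith
      ultimately show "\<exists>y. ((\<lambda>u. 1 + u + u\<^sup>2 / 2 - exp u) has_real_derivative y) (at x) \<and> y \<le> 0" by blast
    qed
    then show ?thesis by simp
  qed
  from le[OF assms] show "exp v \<le> 1 + v + v\<^sup>2 / 2" .
  have "(\<lambda>u. exp u - (1 + u + u\<^sup>2 / 2 + u ^ 3 / 6)) v \<ge> (\<lambda>u. exp u - (1 + u + u\<^sup>2 / 2 + u ^ 3 / 6)) 0"
  proof (rule DERIV_nonpos_imp_nonincreasing[OF assms])
    fix x :: real assume "x \<le> 0"
    have "((\<lambda>u. exp u - (1 + u + u\<^sup>2 / 2 + u ^ 3 / 6)) has_real_derivative exp x - (1 + x + x\<^sup>2 / 2)) (at x)"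
      by (auto intro!: derivative_eq_intros)
    moreover have "exp x - (1 + x + x\<^sup>2 / 2) \<le> 0" using le[OF \<open>x \<le> 0\<close>] by linarith
    ultimately show "\<exists>y. ((\<lambda>u. exp u - (1 + u + u\<^sup>2 / 2 + u ^ 3 / 6)) has_real_derivative y) (at x) \<and> y \<le> 0" by blast
  qed
  then show "1 + v + v\<^sup>2 / 2 + v ^ 3 / 6 \<le> exp v" by simp
qed

lemma deficit_integral_nonpos:
  assumes \<delta>: "\<delta> > 0" and h: "h \<ge> 0"
  shows "deficit_integral \<delta> (- h) 0 = ennreal ((h - (1 - exp (- \<delta> * h)) / \<delta>) / \<delta>)"
proof -
  have "deficit_integral \<delta> (- h) 0 = (\<integral>\<^sup>+u. ennreal ((1 - exp (\<delta> * u)) / \<delta>) * indicator {- h..0} u \<partial>lborel)"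
    unfolding deficit_integral_def
  proof (rule nn_integral_cong_AE)
    show "AE u in lborel. (if - h < u \<and> u \<le> 0 then ennreal (deficit \<delta> u) else 0)
        = ennreal ((1 - exp (\<delta> * u)) / \<delta>) * indicator {- h..0} u"
      using AE_lborel_singleton[of "- h"]
      by eventually_elim (auto simp: deficit_nonpos indicator_def)
  qed
  also have "\<dots> = ennreal ((0 - exp (\<delta> * 0) / \<delta>) / \<delta> - (- h - exp (\<delta> * (- h)) / \<delta>) / \<delta>)"
  proof (rule nn_integral_FTC_Icc[where F = "\<lambda>u. (u - exp (\<delta> * u) / \<delta>) / \<delta>"])
    fix u :: real
    show "((\<lambda>u. (u - exp (\<delta> * u) / \<delta>) / \<delta>) has_real_derivative (1 - exp (\<delta> * u)) / \<delta>) (at u)"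
      using \<delta> by (auto intro!: derivative_eq_intros)
    assume "u \<in> {- h..0}"
    then show "0 \<le> (1 - exp (\<delta> * u)) / \<delta>"
      using \<delta> by (auto simp: mult_nonneg_nonpos)
  qed (use h in auto)
  also have "(0 - exp (\<delta> * 0) / \<delta>) / \<delta> - (- h - exp (\<delta> * (- h)) / \<delta>) / \<delta> = (h - (1 - exp (- \<delta> * h)) / \<delta>) / \<delta>"
    using \<delta> by (simp add: field_simps)
  finally show ?thesis .
qed

text \<open>The boundary integral over a ladder step of height \<open>h\<close> is \<open>h\<^sup>2/2\<close> up to an error of order \<open>\<delta>\<close>. Hence the second
  moment in \<open>\<rho>\<close>.\<close>

lemma deficit_primitive_bounds:
  fixes h :: real
  assumes \<delta>: "\<delta> > 0" and h: "h \<ge> 0"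
  shows "(h - (1 - exp (- \<delta> * h)) / \<delta>) / \<delta> \<le> h\<^sup>2 / 2"
    and "h\<^sup>2 / 2 - \<delta> * h ^ 3 / 6 \<le> (h - (1 - exp (- \<delta> * h)) / \<delta>) / \<delta>"
proof -
  define v where "v = - \<delta> * h"
  have v: "v \<le> 0" using \<delta> h by (simp add: v_def)
  have eq: "(h - (1 - exp (- \<delta> * h)) / \<delta>) / \<delta> = (exp v - 1 - v) / \<delta>\<^sup>2"
    using \<delta> by (simp add: v_def field_simps power2_eq_square)
  have "(exp v - 1 - v) / \<delta>\<^sup>2 \<le> (v\<^sup>2 / 2) / \<delta>\<^sup>2"
    using exp_nonpos_bounds(1)[OF v] by (intro divide_right_mono) auto
  then show "(h - (1 - exp (- \<delta> * h)) / \<delta>) / \<delta> \<le> h\<^sup>2 / 2"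
    unfolding eq using \<delta> by (simp add: v_def power_mult_distrib)
  have "(v\<^sup>2 / 2 + v ^ 3 / 6) / \<delta>\<^sup>2 \<le> (exp v - 1 - v) / \<delta>\<^sup>2"
    using exp_nonpos_bounds(2)[OF v] by (intro divide_right_mono) auto
  moreover have "(v\<^sup>2 / 2 + v ^ 3 / 6) / \<delta>\<^sup>2 = h\<^sup>2 / 2 - \<delta> * h ^ 3 / 6"
    using \<delta> by (simp add: v_def field_simps power2_eq_square power3_eq_cube)
  ultimately show "h\<^sup>2 / 2 - \<delta> * h ^ 3 / 6 \<le> (h - (1 - exp (- \<delta> * h)) / \<delta>) / \<delta>"
    unfolding eq by simp
qed

section \<open>The corrected exponential limit\<close>

text \<open>If the deficit is nearly constant on \<open>[Y - L, Y]\<close>, the left side of the integrated renewal equation is nearly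
  \<open>deficit \<delta> Y\<close> times the mean ladder height, while the right side is nearly half the second moment. Ladder heights
  above \<open>L\<close> are absorbed by the fourth moment.\<close>

lemma deficit_estimate:
  assumes \<delta>: "0 < \<delta>" "\<delta> \<le> 1" and c: "1 \<le> c"
    and bound: "\<And>y. 0 < y \<Longrightarrow> deficit \<delta> y \<le> c"
    and C: "(\<integral>\<omega>. ladder_height \<delta> \<omega> ^ 4 \<partial>paths) \<le> C"
    and Y: "0 < Y" and L: "1 \<le> L" and \<epsilon>: "0 \<le> \<epsilon>"
    and flat: "\<And>u. Y - L \<le> u \<Longrightarrow> u \<le> Y \<Longrightarrow> \<bar>deficit \<delta> u - deficit \<delta> Y\<bar> \<le> \<epsilon>"
  shows "\<bar>deficit \<delta> Y * (\<integral>\<omega>. ladder_height \<delta> \<omega> \<partial>paths) - (\<integral>\<omega>. (ladder_height \<delta> \<omega>)\<^sup>2 \<partial>paths) / 2\<bar>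
    \<le> \<epsilon> * (\<integral>\<omega>. ladder_height \<delta> \<omega> \<partial>paths) + (c + 1) * C / L\<^sup>2 + \<delta> * (1 + C)"
proof -
  define h where "h = ladder_height \<delta>"
  define K where "K = deficit \<delta> Y"
  define g where "g t = (t - (1 - exp (- \<delta> * t)) / \<delta>) / \<delta>" for t :: real
  \<comment> \<open>error bound for the window integral over a ladder step of height \<open>t\<close>: flatness for \<open>t \<le> L\<close>, the crude bound \<open>c + t\<close> on the deficit for \<open>t > L\<close>\<close>
  define b where "b t = \<epsilon> * t + (c + 1) / L\<^sup>2 * t ^ 4" for t :: real
  define m1 where "m1 = (\<integral>\<omega>. h \<omega> \<partial>paths)"
  define m2 where "m2 = (\<integral>\<omega>. (h \<omega>)\<^sup>2 \<partial>paths)"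
  define m4 where "m4 = (\<integral>\<omega>. h \<omega> ^ 4 \<partial>paths)"
  define G where "G = (\<integral>\<omega>. g (h \<omega>) \<partial>paths)"
  have [measurable]: "h \<in> borel_measurable paths" "g \<in> borel_measurable borel" "b \<in> borel_measurable borel"
    unfolding h_def g_def b_def by measurable
  have h_int: "integrable paths h" "integrable paths (\<lambda>\<omega>. (h \<omega>)\<^sup>2)" "integrable paths (\<lambda>\<omega>. h \<omega> ^ 4)"
    unfolding h_def using \<delta> by (auto intro: integrable_ladder_height integrable_ladder_height_power)
  have h_nonneg: "AE \<omega> in paths. 0 \<le> h \<omega>"
    unfolding h_def using \<delta> by (intro ladder_height_nonneg) simp
  have K: "0 \<le> K" "K \<le> c"
    unfolding K_def using deficit_nonneg[OF \<delta>(1)] bound[OF Y] by auto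
  have b_nonneg: "0 \<le> b t" if "0 \<le> t" for t
    using that c \<epsilon> by (simp add: b_def)
  have b_int: "integrable paths (\<lambda>\<omega>. b (h \<omega>))" and b_eq: "(\<integral>\<omega>. b (h \<omega>) \<partial>paths) = \<epsilon> * m1 + (c + 1) / L\<^sup>2 * m4"
    unfolding b_def m1_def m4_def using h_int by auto
  have tail: "(c + t) * t \<le> b t" if "L < t" for t
  proof -
    have "(c + t) * t \<le> (c + 1) * t\<^sup>2"
    proof -
      have "c * t \<le> c * t\<^sup>2" using that L c by (intro mult_left_mono) (auto simp: power2_eq_square)
      then show ?thesis by (simp add: algebra_simps power2_eq_square)
    qed
    also have "\<dots> \<le> (c + 1) * (t ^ 4 / L\<^sup>2)"
    proof (rule mult_left_mono)
      have "L\<^sup>2 * t\<^sup>2 \<le> t\<^sup>2 * t\<^sup>2" using that L by (intro mult_right_mono power_mono) auto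
      then show "t\<^sup>2 \<le> t ^ 4 / L\<^sup>2" using L by (simp add: field_simps flip: power_add)
    qed (use c in simp)
    also have "\<dots> \<le> b t" using that L \<epsilon> by (simp add: b_def)
    finally show ?thesis .
  qed
  have upper: "deficit_integral \<delta> (Y - t) Y \<le> ennreal (K * t + b t)" if t: "0 \<le> t" for t
  proof (cases "t \<le> L")
    case True
    have "deficit_integral \<delta> (Y - t) Y \<le> ennreal ((K + \<epsilon>) * (Y - (Y - t)))"
    proof (rule deficit_integral_le)
      fix u assume "Y - t < u" "u \<le> Y"
      then show "deficit \<delta> u \<le> K + \<epsilon>" using flat[of u] True by (simp add: K_def)
    qed (use t K \<epsilon> in auto)
    also have "\<dots> \<le> ennreal (K * t + b t)"
      using c t by (intro ennreal_leI) (simp add: b_def algebra_simps)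
    finally show ?thesis .
  next
    case False
    have "deficit_integral \<delta> (Y - t) Y \<le> ennreal ((c + t) * (Y - (Y - t)))"
    proof (rule deficit_integral_le)
      fix u assume u: "Y - t < u" "u \<le> Y"
      show "deficit \<delta> u \<le> c + t"
      proof (cases "0 < u")
        case True
        then show ?thesis using bound[of u] t by linarith
      next
        case False
        then show ?thesis using deficit_nonpos_le[OF \<delta>(1), of u] u Y c by linarith
      qed
    qed (use t c in auto)
    also have "\<dots> \<le> ennreal (K * t + b t)"
    proof (rule ennreal_leI)
      have "0 \<le> K * t" using K t by simp
      then show "(c + t) * (Y - (Y - t)) \<le> K * t + b t" using tail[of t] False by simp
    qed
    finally show ?thesis .
  qed
  have lower: "ennreal (K * t) \<le> deficit_integral \<delta> (Y - t) Y + ennreal (b t)" if t: "0 \<le> t" for t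
  proof (cases "t \<le> L")
    case True
    have "ennreal ((K - \<epsilon>) * (Y - (Y - t))) \<le> deficit_integral \<delta> (Y - t) Y"
    proof (rule deficit_integral_ge)
      fix u assume "Y - t < u" "u \<le> Y"
      then show "K - \<epsilon> \<le> deficit \<delta> u" using flat[of u] True by (simp add: K_def)
    qed (use t in simp)
    moreover have "ennreal (K * t) \<le> ennreal ((K - \<epsilon>) * t) + ennreal (\<epsilon> * t)"
    proof (cases "\<epsilon> \<le> K")
      case True
      then show ?thesis using t \<epsilon> by (subst ennreal_plus[symmetric]) (auto simp: algebra_simps intro: mult_right_mono)
    next
      case False
      then show ?thesis using t by (intro add_increasing ennreal_leI mult_right_mono) auto
    qed
    moreover have "ennreal (\<epsilon> * t) \<le> ennreal (b t)"
      using c t by (intro ennreal_leI) (simp add: b_def)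
    ultimately show ?thesis
      by (simp add: add_mono order_trans[OF _ add_mono])
  next
    case False
    have "K * t \<le> (c + t) * t" using K t by (intro mult_right_mono) auto
    then have "K * t \<le> b t" using tail[of t] False by simp
    then show ?thesis by (intro add_increasing ennreal_leI) auto
  qed
  have g_bounds: "0 \<le> g t" "g t \<le> t\<^sup>2 / 2" "t\<^sup>2 / 2 - \<delta> * (1 + t ^ 4) \<le> g t" if t: "0 \<le> t" for t
  proof -
    show "g t \<le> t\<^sup>2 / 2"
      unfolding g_def by (rule deficit_primitive_bounds[OF \<delta>(1) t])
    have "t ^ 3 \<le> 1 + t ^ 4" "0 \<le> t ^ 4" using abs_power_le_one_plus_quartic[of 3 t] t by simp_all
    then have "t ^ 3 / 6 \<le> 1 + t ^ 4" by linarith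
    then have "\<delta> * (t ^ 3 / 6) \<le> \<delta> * (1 + t ^ 4)" using \<delta> by (intro mult_left_mono) auto
    moreover have "t\<^sup>2 / 2 - \<delta> * t ^ 3 / 6 \<le> g t"
      unfolding g_def by (rule deficit_primitive_bounds[OF \<delta>(1) t])
    ultimately show "t\<^sup>2 / 2 - \<delta> * (1 + t ^ 4) \<le> g t" by simp
    have "1 - exp (- \<delta> * t) \<le> \<delta> * t" using exp_ge_add_one_self[of "- \<delta> * t"] by simp
    then have "(1 - exp (- \<delta> * t)) / \<delta> \<le> t" using \<delta> by (simp add: field_simps)
    then show "0 \<le> g t" using \<delta> by (simp add: g_def)
  qed
  have g_int: "integrable paths (\<lambda>\<omega>. g (h \<omega>))"
  proof (rule Bochner_Integration.integrable_bound[of _ "\<lambda>\<omega>. (h \<omega>)\<^sup>2 / 2"])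
    show "AE \<omega> in paths. norm (g (h \<omega>)) \<le> norm ((h \<omega>)\<^sup>2 / 2)"
      using h_nonneg by eventually_elim (use g_bounds in auto)
  qed (use h_int in auto)
  have G_nonneg: "0 \<le> G"
    unfolding G_def using h_nonneg by (intro integral_nonneg_AE) (auto elim!: eventually_mono intro: g_bounds)
  have G_le: "G \<le> m2 / 2"
  proof -
    have "G \<le> (\<integral>\<omega>. (h \<omega>)\<^sup>2 / 2 \<partial>paths)"
      unfolding G_def
    proof (rule integral_mono_AE[OF g_int])
      show "AE \<omega> in paths. g (h \<omega>) \<le> (h \<omega>)\<^sup>2 / 2"
        using h_nonneg by eventually_elim (rule g_bounds)
    qed (use h_int in simp)
    then show ?thesis by (simp add: m2_def)
  qed
  have G_ge: "m2 / 2 - \<delta> * (1 + m4) \<le> G"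
  proof -
    have "(\<integral>\<omega>. (h \<omega>)\<^sup>2 / 2 - \<delta> * (1 + h \<omega> ^ 4) \<partial>paths) \<le> G"
      unfolding G_def
    proof (rule integral_mono_AE[OF _ g_int])
      show "AE \<omega> in paths. (h \<omega>)\<^sup>2 / 2 - \<delta> * (1 + h \<omega> ^ 4) \<le> g (h \<omega>)"
        using h_nonneg by eventually_elim (rule g_bounds)
    qed (use h_int in simp)
    moreover have "(\<integral>\<omega>. (h \<omega>)\<^sup>2 / 2 - \<delta> * (1 + h \<omega> ^ 4) \<partial>paths) = m2 / 2 - \<delta> * (1 + m4)"
      unfolding m2_def m4_def using h_int by (simp add: paths.prob_space[simplified])
    ultimately show ?thesis by simp
  qed
  have "(\<integral>\<^sup>+\<omega>. deficit_integral \<delta> (Y - h \<omega>) Y \<partial>paths) = (\<integral>\<^sup>+\<omega>. deficit_integral \<delta> (- h \<omega>) 0 \<partial>paths)"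
    unfolding h_def by (rule integrated_renewal[OF \<delta>(1) Y])
  also have "\<dots> = (\<integral>\<^sup>+\<omega>. ennreal (g (h \<omega>)) \<partial>paths)"
    using h_nonneg by (intro nn_integral_cong_AE) (auto elim!: eventually_mono simp: deficit_integral_nonpos[OF \<delta>(1)] g_def)
  also have "\<dots> = ennreal G"
    unfolding G_def using h_nonneg by (intro nn_integral_eq_integral g_int) (auto elim!: eventually_mono intro: g_bounds)
  finally have E: "(\<integral>\<^sup>+\<omega>. deficit_integral \<delta> (Y - h \<omega>) Y \<partial>paths) = ennreal G" .
  have bh_nonneg: "0 \<le> (\<integral>\<omega>. b (h \<omega>) \<partial>paths)"
    using h_nonneg by (intro integral_nonneg_AE) (auto elim!: eventually_mono intro: b_nonneg)
  have m1: "0 \<le> m1"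
    unfolding m1_def using h_nonneg by (intro integral_nonneg_AE) (auto elim!: eventually_mono)
  have "ennreal G \<le> (\<integral>\<^sup>+\<omega>. ennreal (K * h \<omega> + b (h \<omega>)) \<partial>paths)"
    unfolding E[symmetric] using h_nonneg by (intro nn_integral_mono_AE) (auto elim!: eventually_mono intro: upper)
  also have "\<dots> = ennreal (\<integral>\<omega>. K * h \<omega> + b (h \<omega>) \<partial>paths)"
    using h_nonneg h_int b_int K
    by (intro nn_integral_eq_integral) (auto elim!: eventually_mono intro!: add_nonneg_nonneg mult_nonneg_nonneg b_nonneg)
  also have "(\<integral>\<omega>. K * h \<omega> + b (h \<omega>) \<partial>paths) = K * m1 + (\<integral>\<omega>. b (h \<omega>) \<partial>paths)"
    unfolding m1_def using h_int b_int by simp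
  finally have G_upper: "G \<le> K * m1 + (\<integral>\<omega>. b (h \<omega>) \<partial>paths)"
    using K m1 bh_nonneg by (subst (asm) ennreal_le_iff) auto
  have "ennreal (K * m1) = (\<integral>\<^sup>+\<omega>. ennreal (K * h \<omega>) \<partial>paths)"
    unfolding m1_def using h_nonneg h_int K
    by (subst nn_integral_eq_integral) (auto elim!: eventually_mono)
  also have "\<dots> \<le> (\<integral>\<^sup>+\<omega>. deficit_integral \<delta> (Y - h \<omega>) Y + ennreal (b (h \<omega>)) \<partial>paths)"
    using h_nonneg by (intro nn_integral_mono_AE) (auto elim!: eventually_mono intro: lower)
  also have "\<dots> = ennreal G + (\<integral>\<^sup>+\<omega>. ennreal (b (h \<omega>)) \<partial>paths)"
    unfolding E[symmetric] by (rule nn_integral_add) measurable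
  also have "(\<integral>\<^sup>+\<omega>. ennreal (b (h \<omega>)) \<partial>paths) = ennreal (\<integral>\<omega>. b (h \<omega>) \<partial>paths)"
    using h_nonneg by (intro nn_integral_eq_integral b_int) (auto elim!: eventually_mono intro: b_nonneg)
  also have "ennreal G + \<dots> = ennreal (G + (\<integral>\<omega>. b (h \<omega>) \<partial>paths))"
    using G_nonneg bh_nonneg by (rule ennreal_plus[symmetric])
  finally have G_lower: "K * m1 \<le> G + (\<integral>\<omega>. b (h \<omega>) \<partial>paths)"
    using G_nonneg bh_nonneg by (subst (asm) ennreal_le_iff) auto
  have m4: "m4 \<le> C" using C by (simp add: m4_def h_def)
  have "(c + 1) / L\<^sup>2 * m4 \<le> (c + 1) / L\<^sup>2 * C"
    using m4 c by (intro mult_left_mono) auto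
  moreover have "\<delta> * (1 + m4) \<le> \<delta> * (1 + C)"
    using m4 \<delta> by (intro mult_left_mono) auto
  ultimately have "\<bar>K * m1 - m2 / 2\<bar> \<le> \<epsilon> * m1 + (c + 1) / L\<^sup>2 * C + \<delta> * (1 + C)"
    using G_le G_ge G_upper G_lower unfolding b_eq by linarith
  then show ?thesis
    by (simp add: K_def m1_def m2_def h_def)
qed

text \<open>The uniform renewal theorem needed here: drift and level may move together, as long as the level tends to
  infinity.\<close>

lemma deficit_tendsto:
  assumes Y: "filterlim Y at_top (at_right 0)"
  shows "((\<lambda>\<delta>. deficit \<delta> (Y \<delta>)) \<longlongrightarrow> limiting_overshoot) (at_right 0)"
proof -
  define m1 where "m1 \<delta> = (\<integral>\<omega>. ladder_height \<delta> \<omega> \<partial>paths)" for \<delta>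
  define m2 where "m2 \<delta> = (\<integral>\<omega>. (ladder_height \<delta> \<omega>)\<^sup>2 \<partial>paths)" for \<delta>
  have m1: "(m1 \<longlongrightarrow> m1 0) (at_right 0)"
    using ladder_moment_tendsto[of 1] by (simp add: m1_def[abs_def])
  have m2: "(m2 \<longlongrightarrow> m2 0) (at_right 0)"
    using ladder_moment_tendsto[of 2] by (simp add: m2_def[abs_def])
  have pos: "0 < m1 0" using expected_ladder_height_pos by (simp add: m1_def)
  obtain c where c: "c \<ge> 1" and bound: "\<And>\<delta> y. 0 < \<delta> \<Longrightarrow> \<delta> \<le> 1 \<Longrightarrow> 0 < y \<Longrightarrow> deficit \<delta> y \<le> c"
    using deficit_bounds by blast
  obtain C where C': "\<And>\<delta>. 0 \<le> \<delta> \<Longrightarrow> \<delta> \<le> 1 \<Longrightarrow> (\<integral>\<omega>. ladder_height \<delta> \<omega> ^ 4 \<partial>paths) \<le> C"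
    using ladder_moment_bound by blast
  have C0: "0 \<le> C" using C'[of 0] by (rule order_trans[rotated]) auto
  have "((\<lambda>\<delta>. deficit \<delta> (Y \<delta>) * m1 \<delta> - m2 \<delta> / 2) \<longlongrightarrow> 0) (at_right 0)"
  proof (rule tendstoI)
    fix \<eta> :: real assume \<eta>: "\<eta> > 0"
    define \<epsilon> where "\<epsilon> = \<eta> / (4 * (m1 0 + 1))"
    \<comment> \<open>large enough for the fourth-moment error, since \<open>L \<le> L\<^sup>2\<close>\<close>
    define L where "L = 1 + 4 * (c + 1) * C / \<eta>"
    have \<epsilon>: "\<epsilon> > 0" using \<eta> pos by (simp add: \<epsilon>_def)
    have L: "L \<ge> 1" using \<eta> c C0 by (simp add: L_def)
    have small_L: "(c + 1) * C / L\<^sup>2 \<le> \<eta> / 4"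
    proof -
      have "(c + 1) * C \<le> \<eta> / 4 * L" using \<eta> by (simp add: L_def field_simps)
      also have "\<dots> \<le> \<eta> / 4 * L\<^sup>2"
        using \<eta> L by (intro mult_left_mono) (auto simp: power2_eq_square)
      finally show ?thesis using L by (simp add: field_simps)
    qed
    obtain Y0 where Y0: "Y0 > 0"
      and flat: "\<And>\<delta> x y. 0 < \<delta> \<Longrightarrow> \<delta> \<le> 1 \<Longrightarrow> Y0 \<le> x \<Longrightarrow> Y0 \<le> y \<Longrightarrow> \<bar>x - y\<bar> \<le> L \<Longrightarrow> \<bar>deficit \<delta> x - deficit \<delta> y\<bar> \<le> \<epsilon>"
      using deficit_locally_flat[OF \<epsilon>, of L] L by auto
    have "\<forall>\<^sub>F \<delta> in at_right 0. Y0 + L \<le> Y \<delta>"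
      using Y by (simp add: filterlim_at_top)
    moreover have "\<forall>\<^sub>F \<delta> in at_right 0. m1 \<delta> < m1 0 + 1"
      using m1 by (rule order_tendstoD) simp
    moreover have "\<forall>\<^sub>F \<delta> in at_right 0. \<delta> * (1 + C) < \<eta> / 4"
    proof (rule order_tendstoD)
      show "((\<lambda>\<delta>. \<delta> * (1 + C)) \<longlongrightarrow> 0 * (1 + C)) (at_right 0)"
        by (intro tendsto_intros)
    qed (use \<eta> in simp)
    moreover have "\<forall>\<^sub>F \<delta> in at_right (0::real). \<delta> < 1"
      by (rule order_tendstoD(2)[OF tendsto_ident_at]) simp
    moreover have "\<forall>\<^sub>F \<delta> in at_right (0::real). 0 < \<delta>"
      by (rule eventually_at_right_less)
    ultimately show "\<forall>\<^sub>F \<delta> in at_right 0. dist (deficit \<delta> (Y \<delta>) * m1 \<delta> - m2 \<delta> / 2) 0 < \<eta>"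
    proof eventually_elim
      case (elim \<delta>)
      have "\<bar>deficit \<delta> (Y \<delta>) * m1 \<delta> - m2 \<delta> / 2\<bar> \<le> \<epsilon> * m1 \<delta> + (c + 1) * C / L\<^sup>2 + \<delta> * (1 + C)"
        unfolding m1_def m2_def
      proof (rule deficit_estimate)
        fix u assume "Y \<delta> - L \<le> u" "u \<le> Y \<delta>"
        then show "\<bar>deficit \<delta> u - deficit \<delta> (Y \<delta>)\<bar> \<le> \<epsilon>"
          using elim L by (intro flat) auto
      qed (use elim c bound C' Y0 L \<epsilon> in auto)
      also have "\<epsilon> * m1 \<delta> \<le> \<epsilon> * (m1 0 + 1)"
        using elim \<epsilon> by (intro mult_left_mono) auto
      also have "\<epsilon> * (m1 0 + 1) = \<eta> / 4"
        using pos unfolding \<epsilon>_def by (subst mult_divide_mult_cancel_right[symmetric, of "m1 0 + 1" \<eta> 4]) auto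
      finally show ?case
        using small_L elim \<eta> by (simp add: dist_real_def)
    qed
  qed
  from tendsto_divide[OF tendsto_add[OF this tendsto_divide[OF m2 tendsto_const[of "2::real"]]] m1]
  have "((\<lambda>\<delta>. (deficit \<delta> (Y \<delta>) * m1 \<delta>) / m1 \<delta>) \<longlongrightarrow> limiting_overshoot) (at_right 0)"
    using pos by (simp add: limiting_overshoot_def m1_def m2_def)
  moreover have "\<forall>\<^sub>F \<delta> in at_right 0. (deficit \<delta> (Y \<delta>) * m1 \<delta>) / m1 \<delta> = deficit \<delta> (Y \<delta>)"
    using order_tendstoD(1)[OF m1 pos] by eventually_elim simp
  ultimately show ?thesis by (rule Lim_transform_eventually)
qed

text \<open>The problem depends on the steps only through their joint law, so it can be transported to the sequence space.\<close>

lemma distr_paths: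
  assumes "prob_space P" "prob_space.indep_vars P (\<lambda>_. borel) X {1..}"
    and X: "\<And>i. i \<ge> 1 \<Longrightarrow> distributed P lborel (X i) std_normal_density"
  shows "(\<lambda>\<omega> i. X (Suc i) \<omega>) \<in> measurable P paths"
    and "distr P paths (\<lambda>\<omega> i. X (Suc i) \<omega>) = paths"
proof -
  interpret prob_space P by fact
  have X_law: "X (Suc i) \<in> borel_measurable P" "distr P borel (X (Suc i)) = gauss" for i
  proof -
    have D: "distributed P lborel (X (Suc i)) std_normal_density" by (rule X) simp
    then show "X (Suc i) \<in> borel_measurable P" by (auto simp: distributed_def)
    have "distr P borel (X (Suc i)) = distr P lborel (X (Suc i))" by (rule distr_cong) auto
    also have "\<dots> = gauss" using D by (simp add: distributed_def gauss_def)
    finally show "distr P borel (X (Suc i)) = gauss" .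
  qed
  note [measurable] = X_law(1)
  show meas: "(\<lambda>\<omega> i. X (Suc i) \<omega>) \<in> measurable P paths"
    by (rule measurable_PiM_single') (auto simp: measurable_cong_sets[OF refl sets_gauss])
  have indep: "indep_sets (\<lambda>i. {X i -` A \<inter> space P |A. A \<in> sets borel}) {1..}"
    using assms(2) by (simp add: indep_vars_def2)
  have "indep_sets (\<lambda>i. {X (Suc i) -` A \<inter> space P |A. A \<in> sets borel}) UNIV"
  proof (rule indep_setsI)
    show "{X (Suc i) -` A \<inter> space P |A. A \<in> sets borel} \<subseteq> events" for i
      using measurable_sets[OF X_law(1)] by auto
    fix A :: "nat \<Rightarrow> 'a set" and J :: "nat set"
    assume J: "J \<noteq> {}" "finite J" and A: "\<forall>j\<in>J. A j \<in> {X (Suc j) -` A \<inter> space P |A. A \<in> sets borel}"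
    have "prob (\<Inter>i\<in>Suc ` J. A (i - 1)) = (\<Prod>i\<in>Suc ` J. prob (A (i - 1)))"
      by (rule indep_setsD[OF indep]) (use J A in auto)
    then show "prob (\<Inter>j\<in>J. A j) = (\<Prod>j\<in>J. prob (A j))"
      by (simp add: prod.reindex)
  qed
  then have "indep_vars (\<lambda>_. borel) (\<lambda>i. X (Suc i)) UNIV"
    by (simp add: indep_vars_def2)
  then have "distr P (\<Pi>\<^sub>M i\<in>UNIV. borel) (\<lambda>\<omega>. \<lambda>i\<in>UNIV. X (Suc i) \<omega>) = (\<Pi>\<^sub>M i\<in>UNIV. distr P borel (X (Suc i)))"
    by (subst (asm) indep_vars_iff_distr_eq_PiM') auto
  then have "distr P (\<Pi>\<^sub>M i\<in>UNIV. borel) (\<lambda>\<omega> i. X (Suc i) \<omega>) = paths"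
    by (simp add: X_law(2) restrict_def)
  moreover have "distr P (\<Pi>\<^sub>M i\<in>UNIV. borel) (\<lambda>\<omega> i. X (Suc i) \<omega>) = distr P paths (\<lambda>\<omega> i. X (Suc i) \<omega>)"
    by (rule distr_cong) (auto intro!: sets_PiM_cong)
  ultimately show "distr P paths (\<lambda>\<omega> i. X (Suc i) \<omega>) = paths" by simp
qed

lemma walk_eq_position: "walk X \<delta> n \<omega> = position \<delta> (\<lambda>i. X (Suc i) \<omega>) n"
  using sum.atLeast1_atMost_eq[of "\<lambda>i. X i \<omega> - \<delta> / 2" n] by (simp add: walk_def position_def)

lemma walk_max_eq: "walk_max X \<delta> \<omega> = walk_sup \<delta> (\<lambda>i. X (Suc i) \<omega>)"
  by (simp add: walk_max_def walk_sup_def walk_eq_position)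

lemma stopped_walk_eq: "stopped_walk X \<delta> \<omega> = - ladder_height \<delta> (\<lambda>i. X (Suc i) \<omega>)"
  by (simp add: stopped_walk_def tau_minus_def ladder_height_def ladder_time_def walk_eq_position)

lemma rho_eq:
  assumes "prob_space P" "prob_space.indep_vars P (\<lambda>_. borel) X {1..}"
    and "\<And>i. i \<ge> 1 \<Longrightarrow> distributed P lborel (X i) std_normal_density"
  shows "rho P X = limiting_overshoot"
proof -
  have law: "(\<lambda>\<omega> i. X (Suc i) \<omega>) \<in> measurable P paths" "distr P paths (\<lambda>\<omega> i. X (Suc i) \<omega>) = paths"
    by (rule distr_paths[OF assms(1,2)], erule assms(3))+
  define m1 where "m1 \<delta> = (\<integral>\<omega>. ladder_height \<delta> \<omega> \<partial>paths)" for \<delta>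
  define m2 where "m2 \<delta> = (\<integral>\<omega>. (ladder_height \<delta> \<omega>)\<^sup>2 \<partial>paths)" for \<delta>
  have "(\<integral>\<omega>. stopped_walk X \<delta> \<omega> \<partial>P) = - m1 \<delta>" for \<delta>
  proof -
    have "m1 \<delta> = (\<integral>\<omega>. ladder_height \<delta> \<omega> \<partial>distr P paths (\<lambda>\<omega> i. X (Suc i) \<omega>))"
      by (simp add: m1_def law(2))
    then show ?thesis
      by (subst (asm) integral_distr[OF law(1)]) (auto simp: stopped_walk_eq)
  qed
  moreover have "(\<integral>\<omega>. (stopped_walk X \<delta> \<omega>)\<^sup>2 \<partial>P) = m2 \<delta>" for \<delta>
  proof -
    have "m2 \<delta> = (\<integral>\<omega>. (ladder_height \<delta> \<omega>)\<^sup>2 \<partial>distr P paths (\<lambda>\<omega> i. X (Suc i) \<omega>))"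
      by (simp add: m2_def law(2))
    then show ?thesis
      by (subst (asm) integral_distr[OF law(1)]) (auto simp: stopped_walk_eq)
  qed
  moreover have "((\<lambda>\<delta>. m2 \<delta> / (2 * - m1 \<delta>)) \<longlongrightarrow> m2 0 / (2 * - m1 0)) (at_right 0)"
    using ladder_moment_tendsto[of 1] ladder_moment_tendsto[of 2] expected_ladder_height_pos
    by (intro tendsto_intros) (auto simp: m1_def m2_def)
  ultimately have "Lim (at_right 0) (\<lambda>\<delta>. (\<integral>\<omega>. (stopped_walk X \<delta> \<omega>)\<^sup>2 \<partial>P) / (2 * (\<integral>\<omega>. stopped_walk X \<delta> \<omega> \<partial>P)))
      = m2 0 / (2 * - m1 0)"
    by (intro tendsto_Lim) auto
  then show ?thesis
    unfolding rho_def limiting_overshoot_def by (simp add: m1_def m2_def)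
qed

theorem corollary2:
  fixes P :: "'a measure" and X :: "nat \<Rightarrow> 'a \<Rightarrow> real" and x :: real
  assumes "prob_space P"
    and "prob_space.indep_vars P (\<lambda>_. borel) X {1..}"
    and "\<And>i. i \<ge> 1 \<Longrightarrow> distributed P lborel (X i) std_normal_density"
    and "x > 0"
  shows "\<exists>r. r \<in> o[at_right 0](\<lambda>\<delta>. \<delta>) \<and>
    (\<forall>\<delta>>0. measure P {\<omega> \<in> space P. ereal \<delta> * (walk_max X \<delta> \<omega> + ereal (rho P X)) < ereal x}
       = 1 - exp (- x) * (1 + r \<delta>))"
proof -
  have law: "(\<lambda>\<omega> i. X (Suc i) \<omega>) \<in> measurable P paths" "distr P paths (\<lambda>\<omega> i. X (Suc i) \<omega>) = paths"
    by (rule distr_paths[OF assms(1,2)], erule assms(3))+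
  define \<rho> where "\<rho> = limiting_overshoot"
  have rho: "rho P X = \<rho>"
    unfolding \<rho>_def by (rule rho_eq[OF assms(1,2)]) (rule assms(3))
  define Y where "Y \<delta> = x / \<delta> - \<rho>" for \<delta> :: real
  define r where "r \<delta> = exp x * sup_tail \<delta> (Y \<delta>) - 1" for \<delta>
  have prob: "measure P {\<omega> \<in> space P. ereal \<delta> * (walk_max X \<delta> \<omega> + ereal (rho P X)) < ereal x}
      = 1 - exp (- x) * (1 + r \<delta>)" if \<delta>: "\<delta> > 0" for \<delta>
  proof -
    \<comment> \<open>stated for all extended real values, since the supremum may be infinite on a null set\<close>
    have iff: "ereal \<delta> * (m + ereal \<rho>) < ereal x \<longleftrightarrow> \<not> ereal (Y \<delta>) \<le> m" for m
      using \<delta> by (cases m) (auto simp: Y_def field_simps not_le)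
    have "measure P {\<omega> \<in> space P. ereal \<delta> * (walk_max X \<delta> \<omega> + ereal (rho P X)) < ereal x}
        = measure P ((\<lambda>\<omega> i. X (Suc i) \<omega>) -` {\<omega>. \<not> ereal (Y \<delta>) \<le> walk_sup \<delta> \<omega>} \<inter> space P)"
      unfolding rho iff walk_max_eq by (rule arg_cong[where f = "measure P"]) auto
    also have "\<dots> = measure (distr P paths (\<lambda>\<omega> i. X (Suc i) \<omega>)) {\<omega>. \<not> ereal (Y \<delta>) \<le> walk_sup \<delta> \<omega>}"
      by (rule measure_distr[symmetric, OF law(1)]) (rule sets_paths_Collect, measurable)
    also have "\<dots> = measure paths (space paths - {\<omega>. ereal (Y \<delta>) \<le> walk_sup \<delta> \<omega>})"
      by (simp add: law(2) Compl_eq_Diff_UNIV[symmetric] Collect_neg_eq)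
    also have "\<dots> = 1 - sup_tail \<delta> (Y \<delta>)"
      unfolding sup_tail_def by (rule paths.prob_compl) (rule sets_le_walk_sup)
    finally show ?thesis
      by (simp add: r_def mult.assoc[symmetric] exp_add[symmetric])
  qed
  have "((\<lambda>\<delta>. r \<delta> / \<delta>) \<longlongrightarrow> 0) (at_right 0)"
  proof -
    have "filterlim (\<lambda>\<delta>. x * inverse \<delta> + - \<rho>) at_top (at_right 0)"
      using assms(4) by (intro filterlim_tendsto_add_at_top[of "\<lambda>_. - \<rho>", OF tendsto_const, unfolded add.commute[of "- \<rho>"]]
          filterlim_tendsto_pos_mult_at_top[OF tendsto_const _ filterlim_inverse_at_top_right]) auto
    then have "filterlim Y at_top (at_right 0)"
      by (simp add: Y_def[abs_def] divide_inverse)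
    then have K: "((\<lambda>\<delta>. deficit \<delta> (Y \<delta>)) \<longlongrightarrow> \<rho>) (at_right 0)"
      unfolding \<rho>_def by (rule deficit_tendsto)
    have "((\<lambda>\<delta>. exp (\<delta> * \<rho>)) has_real_derivative \<rho>) (at 0)"
      by (auto intro!: derivative_eq_intros)
    then have D: "((\<lambda>\<delta>. (exp (\<delta> * \<rho>) - 1) / \<delta>) \<longlongrightarrow> \<rho>) (at_right 0)"
      by (simp add: has_field_derivative_iff filterlim_at_split)
    have "((\<lambda>\<delta>. exp (\<delta> * \<rho>)) \<longlongrightarrow> exp (0 * \<rho>)) (at_right 0)"
      by (intro tendsto_intros)
    from tendsto_diff[OF D tendsto_mult[OF this K]]
    have lim: "((\<lambda>\<delta>. (exp (\<delta> * \<rho>) - 1) / \<delta> - exp (\<delta> * \<rho>) * deficit \<delta> (Y \<delta>)) \<longlongrightarrow> 0) (at_right 0)"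
      by simp
    have "(exp (\<delta> * \<rho>) - 1) / \<delta> - exp (\<delta> * \<rho>) * deficit \<delta> (Y \<delta>) = r \<delta> / \<delta>" if "\<delta> > 0" for \<delta>
    proof -
      have "\<delta> * \<rho> + \<delta> * Y \<delta> = x" using that by (simp add: Y_def field_simps)
      then have "exp (\<delta> * \<rho>) * (exp (\<delta> * Y \<delta>) * sup_tail \<delta> (Y \<delta>)) = exp x * sup_tail \<delta> (Y \<delta>)"
        by (simp add: mult.assoc[symmetric] exp_add[symmetric])
      then show ?thesis using that by (simp add: r_def deficit_def field_simps)
    qed
    then show ?thesis
      by (intro Lim_transform_eventually[OF lim] eventually_mono[OF eventually_at_right_less]) auto
  qed
  then have "r \<in> o[at_right 0](\<lambda>\<delta>. \<delta>)"
    by (intro smalloI_tendsto) (auto intro: eventually_mono[OF eventually_at_right_less])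
  with prob show ?thesis by blast
qed

end
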